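(* Let $\Phi$ be an irreducible crystallographic root system with positive system $\Phi^+$ and ambient Euclidean space $V$, and let $R$ be a region of the Shi arrangement of $\Phi$. Let $A_R$ be the minimal alcove of $R$. Then the floors of $A_R$ are exactly the floors of $R$.
   Context: For $\alpha\in\Phi$ and $d\in\mathbb Z$ let $H_\alpha^d=\{x\in V:\langle x,\alpha\rangle=d\}$. The affine Coxeter arrangement consists of all $H_\alpha^d$ with $\alpha\in\Phi$, $d\in\mathbb Z$; the connected components of the complement of the union of these hyperplanes are called alcoves. The Shi arrangement consists of the hyperplanes $H_\alpha^d$ with $\alpha\in\Phi^+$ and $d\in\{0,1\}$; the connected components of the complement of their union are its regions. For an alcove $A$ and $\alpha\in\Phi^+$, let $k(A,\alpha)$ be the unique integer $k$ with $k<\langle x,\alpha\rangle<k+1$ for all $x\in A$. Every Shi region $R$ contains a unique alcove $A_R$ (its minimal alcove) such that $|k(A_R,\alpha)|\le|k(A,\alpha)|$ for every $\alpha\in\Phi^+$ and every alcove $A\subseteq R$. The walls of a region (resp. alcove) are the hyperplanes (of the Shi arrangement, resp. of the affine Coxeter arrangement) that support facets of it; its floors are those walls that do not contain the origin and separate it from the origin. *)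

theory Defs
  imports "HOL-Analysis.Analysis"
begin

definition root_reflection :: "'a::euclidean_space \<Rightarrow> 'a \<Rightarrow> 'a" where
  "root_reflection \<alpha> x = x - (2 * (x \<bullet> \<alpha>) / (\<alpha> \<bullet> \<alpha>)) *\<^sub>R \<alpha>"

text \<open>Root systems are reduced, and span the ambient space, which is the whole type.\<close>

definition root_system :: "'a::euclidean_space set \<Rightarrow> bool" where
  "root_system \<Phi> \<longleftrightarrow>
     finite \<Phi> \<and> 0 \<notin> \<Phi> \<and> span \<Phi> = UNIV \<and>
     (\<forall>\<alpha>\<in>\<Phi>. \<Phi> \<inter> span {\<alpha>} = {\<alpha>, - \<alpha>}) \<and>
     (\<forall>\<alpha>\<in>\<Phi>. root_reflection \<alpha> ` \<Phi> = \<Phi>)"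

definition crystallographic :: "'a::euclidean_space set \<Rightarrow> bool" where
  "crystallographic \<Phi> \<longleftrightarrow> (\<forall>\<alpha>\<in>\<Phi>. \<forall>\<beta>\<in>\<Phi>. 2 * (\<beta> \<bullet> \<alpha>) / (\<alpha> \<bullet> \<alpha>) \<in> \<int>)"

definition irreducible_roots :: "'a::euclidean_space set \<Rightarrow> bool" where
  "irreducible_roots \<Phi> \<longleftrightarrow>
     \<Phi> \<noteq> {} \<and>
     (\<nexists>\<Phi>1 \<Phi>2. \<Phi>1 \<noteq> {} \<and> \<Phi>2 \<noteq> {} \<and> \<Phi>1 \<inter> \<Phi>2 = {} \<and> \<Phi>1 \<union> \<Phi>2 = \<Phi> \<and>
        (\<forall>\<alpha>\<in>\<Phi>1. \<forall>\<beta>\<in>\<Phi>2. orthogonal \<alpha> \<beta>))"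

text \<open>A positive system consists of the roots on one side of a hyperplane through the
  origin that contains no root.\<close>

definition positive_system :: "'a::euclidean_space set \<Rightarrow> 'a set \<Rightarrow> bool" where
  "positive_system \<Phi> P \<longleftrightarrow>
     (\<exists>v. (\<forall>\<alpha>\<in>\<Phi>. v \<bullet> \<alpha> \<noteq> 0) \<and> P = {\<alpha>\<in>\<Phi>. v \<bullet> \<alpha> > 0})"

definition root_hyperplane :: "'a::euclidean_space \<Rightarrow> int \<Rightarrow> 'a set" where
  "root_hyperplane \<alpha> d = {x. x \<bullet> \<alpha> = of_int d}"

definition affine_arrangement :: "'a::euclidean_space set \<Rightarrow> 'a set set" where
  "affine_arrangement \<Phi> = {root_hyperplane \<alpha> d | \<alpha> d. \<alpha> \<in> \<Phi>}"

definition shi_arrangement :: "'a::euclidean_space set \<Rightarrow> 'a set set" where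
  "shi_arrangement P = {root_hyperplane \<alpha> d | \<alpha> d. \<alpha> \<in> P \<and> d \<in> {0, 1}}"

definition arrangement_regions :: "'a::euclidean_space set set \<Rightarrow> 'a set set" where
  "arrangement_regions \<A> = components (- \<Union>\<A>)"

definition alcoves :: "'a::euclidean_space set \<Rightarrow> 'a set set" where
  "alcoves \<Phi> = arrangement_regions (affine_arrangement \<Phi>)"

definition shi_regions :: "'a::euclidean_space set \<Rightarrow> 'a set set" where
  "shi_regions P = arrangement_regions (shi_arrangement P)"

definition alcove_coord :: "'a::euclidean_space set \<Rightarrow> 'a \<Rightarrow> int" where
  "alcove_coord A \<alpha> = (THE k. \<forall>x\<in>A. of_int k < x \<bullet> \<alpha> \<and> x \<bullet> \<alpha> < of_int k + 1)"

definition minimal_alcove ::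
  "'a::euclidean_space set \<Rightarrow> 'a set \<Rightarrow> 'a set \<Rightarrow> 'a set \<Rightarrow> bool" where
  "minimal_alcove \<Phi> P R A \<longleftrightarrow>
     A \<in> alcoves \<Phi> \<and> A \<subseteq> R \<and>
     (\<forall>\<alpha>\<in>P. \<forall>B\<in>alcoves \<Phi>. B \<subseteq> R \<longrightarrow> \<bar>alcove_coord A \<alpha>\<bar> \<le> \<bar>alcove_coord B \<alpha>\<bar>)"

text \<open>Regions are open, so their facets are those of their closures.\<close>

definition walls :: "'a::euclidean_space set set \<Rightarrow> 'a set \<Rightarrow> 'a set set" where
  "walls \<A> C = {H\<in>\<A>. (H \<inter> closure C) facet_of closure C}"

definition hyperplane_separates ::
  "'a::euclidean_space set \<Rightarrow> 'a set \<Rightarrow> 'a set \<Rightarrow> bool" where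
  "hyperplane_separates H S T \<longleftrightarrow>
     (\<exists>a b. a \<noteq> 0 \<and> H = {x. a \<bullet> x = b} \<and>
        (\<forall>x\<in>S. a \<bullet> x < b) \<and> (\<forall>x\<in>T. a \<bullet> x > b))"

definition floors :: "'a::euclidean_space set set \<Rightarrow> 'a set \<Rightarrow> 'a set set" where
  "floors \<A> C = {H\<in>walls \<A> C. 0 \<notin> H \<and> hyperplane_separates H {0} C}"

end

theory Submission imports Defs begin

text \<open>
  A hyperplane \<open>H\<^sub>\<alpha>\<^sup>j\<close> is a wall of the alcove of a generic point \<open>p\<close> (with \<open>j < \<langle>p, \<alpha>\<rangle>\<close>) exactly if
  the affine root \<open>(\<alpha>, j)\<close> is not a sum of two affine roots that are positive at \<open>p\<close>.
  If a floor of the minimal alcove were not a Shi hyperplane, crossing it would give an alcove of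
  the same region closer to the origin. Conversely, let \<open>H\<close> be a floor of the region and take an
  alcove \<open>B\<close> of the region with wall \<open>H\<close>. If \<open>B\<close> is not minimal, it has a wall \<open>M\<close> separating it from
  the minimal alcove. The walls \<open>H\<close> and \<open>M\<close> meet at an angle that is not obtuse, hence in a face of
  codimension two, and \<open>H\<close> is the only Shi hyperplane through that face. Rotating \<open>B\<close> about the
  face within its side of \<open>H\<close>, up to the other alcove at \<open>H\<close>, stays in the region and reduces the
  number of hyperplanes separating \<open>B\<close> from the minimal alcove.
\<close>

text \<open>These are the points lying in some alcove; a single point then stands for its
  alcove.\<close>

definition generic_point :: "'a::euclidean_space set \<Rightarrow> 'a \<Rightarrow> bool" where
  "generic_point \<Phi> x \<longleftrightarrow> (\<forall>\<delta>\<in>\<Phi>. x \<bullet> \<delta> \<notin> \<int>)"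

text \<open>The pair \<open>(\<alpha>, j)\<close> stands for the affine function \<open>\<langle>x, \<alpha>\<rangle> - j\<close>. Bounding it by 1 at
  \<open>x\<close> excludes decompositions that split off a positive constant.\<close>

definition simple_affine_root :: "'a::euclidean_space set \<Rightarrow> 'a \<Rightarrow> 'a \<Rightarrow> int \<Rightarrow> bool" where
  "simple_affine_root \<Phi> x \<alpha> j \<longleftrightarrow>
     \<alpha> \<in> \<Phi> \<and> of_int j < x \<bullet> \<alpha> \<and> x \<bullet> \<alpha> < of_int j + 1 \<and>
     (\<nexists>\<delta> \<epsilon> m n. \<delta> \<in> \<Phi> \<and> \<epsilon> \<in> \<Phi> \<and> \<alpha> = \<delta> + \<epsilon> \<and> j = m + n \<and>
        of_int m < x \<bullet> \<delta> \<and> of_int n < x \<bullet> \<epsilon>)"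

text \<open>Of the opposite pairs \<open>(\<delta>, m)\<close> and \<open>(- \<delta>, - m)\<close>
  only the one positive at \<open>x\<close> is listed, so for a root system the cardinality is the
  number of hyperplanes strictly separating \<open>x\<close> from \<open>p\<close>.\<close>

definition separating_roots :: "'a::euclidean_space set \<Rightarrow> 'a \<Rightarrow> 'a \<Rightarrow> ('a \<times> int) set" where
  "separating_roots \<Phi> x p = {(\<delta>, m). \<delta> \<in> \<Phi> \<and> of_int m < x \<bullet> \<delta> \<and> p \<bullet> \<delta> < of_int m}"

section \<open>Small perturbations and integrality\<close>

lemma eventually_near_point:
  fixes \<Phi> :: "'a::euclidean_space set"
  assumes "finite \<Phi>"
  shows "\<forall>\<^sub>F y in nhds z. \<forall>\<delta>\<in>\<Phi>. \<forall>m::int. of_int m < z \<bullet> \<delta> \<longrightarrow> of_int m < y \<bullet> \<delta>"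
proof (intro eventually_ball_finite assms ballI)
  fix \<delta>
  have "((\<lambda>y. y \<bullet> \<delta>) \<longlongrightarrow> z \<bullet> \<delta>) (nhds z)"
    by (intro tendsto_intros filterlim_ident)
  \<comment> \<open>This is the largest integer strictly below the value at \<open>z\<close>, so one
    bound settles all integers \<open>m\<close> at once.\<close>
  moreover have "of_int (\<lceil>z \<bullet> \<delta>\<rceil> - 1) < z \<bullet> \<delta>" by linarith
  ultimately have "\<forall>\<^sub>F y in nhds z. of_int (\<lceil>z \<bullet> \<delta>\<rceil> - 1) < y \<bullet> \<delta>"
    by (rule order_tendstoD)
  then show "\<forall>\<^sub>F y in nhds z. \<forall>m::int. of_int m < z \<bullet> \<delta> \<longrightarrow> of_int m < y \<bullet> \<delta>"
  proof eventually_elim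
    case (elim y)
    show ?case
    proof (intro allI impI)
      fix m :: int
      assume "of_int m < z \<bullet> \<delta>"
      then have "m \<le> \<lceil>z \<bullet> \<delta>\<rceil> - 1" by linarith
      then have "of_int m \<le> (of_int (\<lceil>z \<bullet> \<delta>\<rceil> - 1) :: real)" by (rule of_int_le_iff[THEN iffD2])
      with elim show "of_int m < y \<bullet> \<delta>" by linarith
    qed
  qed
qed

lemma tendsto_ray: "((\<lambda>t. z + t *\<^sub>R v) \<longlongrightarrow> z) (at_right (0::real))"
  for z v :: "'a::euclidean_space"
proof -
  have "((\<lambda>t. z + t *\<^sub>R v) \<longlongrightarrow> z + 0 *\<^sub>R v) (at_right (0::real))"
    by (intro tendsto_intros)
  then show ?thesis by simp
qed

lemma eventually_near_ray:
  fixes \<Phi> :: "'a::euclidean_space set"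
  assumes "finite \<Phi>"
  shows "\<forall>\<^sub>F t in at_right (0::real). \<forall>\<delta>\<in>\<Phi>. \<forall>m::int.
           of_int m < z \<bullet> \<delta> \<longrightarrow> of_int m < (z + t *\<^sub>R v) \<bullet> \<delta>"
  by (rule eventually_compose_filterlim[OF eventually_near_point[OF assms] tendsto_ray])

text \<open>For small positive \<open>t\<close> the value lies strictly between
  \<open>\<lceil>a\<rceil> - 1\<close> and \<open>\<lfloor>a\<rfloor> + 1\<close>; the only integer
  that can lie there is \<open>a\<close> itself, which \<open>b \<noteq> 0\<close> excludes.\<close>

lemma eventually_notin_Ints:
  fixes a b :: real
  assumes "b \<noteq> 0"
  shows "\<forall>\<^sub>F t in at_right 0. a + t * b \<notin> \<int>"
proof -
  have lim: "((\<lambda>t. a + t * b) \<longlongrightarrow> a + 0 * b) (at_right 0)"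
    by (intro tendsto_intros)
  have "\<forall>\<^sub>F t in at_right 0. a + t * b < of_int (\<lfloor>a\<rfloor> + 1)"
    by (rule order_tendstoD(2)[OF lim]) linarith
  moreover have "\<forall>\<^sub>F t in at_right 0. of_int (\<lceil>a\<rceil> - 1) < a + t * b"
    by (rule order_tendstoD(1)[OF lim]) linarith
  moreover have "\<forall>\<^sub>F t in at_right 0. (0::real) < t"
    by (simp add: eventually_at_right_less)
  ultimately show ?thesis
  proof eventually_elim
    case (elim t)
    show ?case
    proof
      assume "a + t * b \<in> \<int>"
      then obtain m where m: "a + t * b = of_int m" by (auto elim: Ints_cases)
      have "m < \<lfloor>a\<rfloor> + 1" "\<lceil>a\<rceil> - 1 < m" using elim m by linarith+
      then have "a = of_int m" by linarith
      then show False using m elim assms by simp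
    qed
  qed
qed

lemma exists_nonorthogonal:
  fixes D :: "'a::euclidean_space set"
  assumes "finite D" "0 \<notin> D"
  shows "\<exists>v. \<forall>d\<in>D. v \<bullet> d \<noteq> 0"
  using assms
proof (induction D rule: finite_induct)
  case (insert e D)
  then obtain v where v: "\<forall>d\<in>D. v \<bullet> d \<noteq> 0" by auto
  have lim: "((\<lambda>t. (v + t *\<^sub>R e) \<bullet> d) \<longlongrightarrow> v \<bullet> d) (at_right (0::real))" for d
    by (intro tendsto_intros tendsto_ray)
  have "\<forall>\<^sub>F t in at_right (0::real). \<forall>d\<in>D. (v + t *\<^sub>R e) \<bullet> d \<noteq> 0"
    using insert.hyps v by (intro eventually_ball_finite ballI tendsto_imp_eventually_ne[OF lim]) auto
  moreover have "\<forall>\<^sub>F t in at_right 0. v \<bullet> e + t * (e \<bullet> e) \<notin> \<int>"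
    using insert.prems by (intro eventually_notin_Ints) auto
  ultimately have "\<forall>\<^sub>F t in at_right (0::real). \<forall>d\<in>insert e D. (v + t *\<^sub>R e) \<bullet> d \<noteq> 0"
    by eventually_elim (auto simp: inner_add_left)
  then have "\<exists>t. \<forall>d\<in>insert e D. (v + t *\<^sub>R e) \<bullet> d \<noteq> 0"
    by (rule eventually_happens'[OF trivial_limit_at_right_real])
  then show ?case by blast
qed auto

subsection \<open>Affine roots at a generic point\<close>

locale crystallographic_root_system =
  fixes \<Phi> :: "'a::euclidean_space set"
  assumes root_system: "root_system \<Phi>" and crystallographic: "crystallographic \<Phi>"
begin

lemma finite_roots: "finite \<Phi>"
  using root_system by (simp add: root_system_def)

lemma root_nonzero: "\<alpha> \<in> \<Phi> \<Longrightarrow> \<alpha> \<noteq> 0"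
  using root_system by (auto simp: root_system_def)

lemma root_in_span_root:
  assumes "\<alpha> \<in> \<Phi>" "c *\<^sub>R \<alpha> \<in> \<Phi>"
  shows "c = 1 \<or> c = -1"
proof -
  have "c *\<^sub>R \<alpha> \<in> \<Phi> \<inter> span {\<alpha>}" using assms by (auto simp: span_scale span_base)
  then have "c *\<^sub>R \<alpha> = \<alpha> \<or> c *\<^sub>R \<alpha> = - \<alpha>"
    using root_system assms by (auto simp: root_system_def)
  then have "(c - 1) *\<^sub>R \<alpha> = 0 \<or> (c + 1) *\<^sub>R \<alpha> = 0" by (auto simp: algebra_simps)
  then show ?thesis using root_nonzero[OF assms(1)] by auto
qed

lemma root_uminus: "\<alpha> \<in> \<Phi> \<Longrightarrow> - \<alpha> \<in> \<Phi>"
  using root_system unfolding root_system_def by blast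

lemma root_reflection_in: "\<alpha> \<in> \<Phi> \<Longrightarrow> \<delta> \<in> \<Phi> \<Longrightarrow> root_reflection \<alpha> \<delta> \<in> \<Phi>"
  using root_system unfolding root_system_def by blast

text \<open>Strict Cauchy-Schwarz: by reducedness \<delta> is not a multiple of \<alpha>, so its
  component orthogonal to \<alpha> is nonzero.\<close>

lemma inner_square_less:
  assumes "\<alpha> \<in> \<Phi>" "\<delta> \<in> \<Phi>" "\<delta> \<noteq> \<alpha>" "\<delta> \<noteq> - \<alpha>"
  shows "(\<alpha> \<bullet> \<delta>)\<^sup>2 < (\<alpha> \<bullet> \<alpha>) * (\<delta> \<bullet> \<delta>)"
proof -
  define c where "c = (\<alpha> \<bullet> \<delta>) / (\<alpha> \<bullet> \<alpha>)"
  have aa: "\<alpha> \<bullet> \<alpha> > 0" using root_nonzero assms by simp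
  have "\<delta> - c *\<^sub>R \<alpha> \<noteq> 0" using root_in_span_root[of \<alpha> c] assms by auto
  then have "0 < (\<delta> - c *\<^sub>R \<alpha>) \<bullet> (\<delta> - c *\<^sub>R \<alpha>)" by simp
  also have "\<dots> = \<delta> \<bullet> \<delta> - (\<alpha> \<bullet> \<delta>)\<^sup>2 / (\<alpha> \<bullet> \<alpha>)"
    using aa by (simp add: c_def inner_diff inner_commute field_simps power2_eq_square)
  finally show ?thesis using aa by (simp add: field_simps)
qed

text \<open>The two Cartan integers \<open>c\<close> and \<open>d\<close> are positive with product
  below 4, so one of them is 1, and the corresponding reflection yields the difference up to
  sign.\<close>

lemma root_diff:
  assumes "\<alpha> \<in> \<Phi>" "\<delta> \<in> \<Phi>" "\<delta> \<noteq> \<alpha>" "\<delta> \<bullet> \<alpha> > 0"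
  shows "\<delta> - \<alpha> \<in> \<Phi>"
proof -
  have pos: "\<alpha> \<bullet> \<alpha> > 0" "\<delta> \<bullet> \<delta> > 0" using root_nonzero assms by simp_all
  have "\<delta> \<noteq> - \<alpha>" using assms(4) pos by (metis inner_minus_left neg_0_less_iff_less order_less_asym)
  obtain c where c: "2 * (\<delta> \<bullet> \<alpha>) / (\<alpha> \<bullet> \<alpha>) = of_int c"
    using crystallographic assms by (meson Ints_cases crystallographic_def)
  obtain d where d: "2 * (\<alpha> \<bullet> \<delta>) / (\<delta> \<bullet> \<delta>) = of_int d"
    using crystallographic assms by (meson Ints_cases crystallographic_def)
  have "of_int c > (0::real)" "of_int d > (0::real)"
    unfolding c[symmetric] d[symmetric] using assms pos by (simp_all add: inner_commute)
  then have cd0: "c > 0" "d > 0" by simp_all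
  have "of_int (c * d) = 4 * (\<alpha> \<bullet> \<delta>)\<^sup>2 / ((\<alpha> \<bullet> \<alpha>) * (\<delta> \<bullet> \<delta>))"
    by (simp add: c[symmetric] d[symmetric] power2_eq_square inner_commute)
  also have "\<dots> < 4"
    using inner_square_less[OF assms(1-3) \<open>\<delta> \<noteq> - \<alpha>\<close>] pos by (simp add: field_simps)
  finally have "c * d < 4" by linarith
  have "c = 1 \<or> d = 1"
  proof (rule ccontr)
    assume "\<not> ?thesis"
    then have "c \<ge> 2" "d \<ge> 2" using cd0 by auto
    then have "2 * 2 \<le> c * d" by (intro mult_mono) auto
    then show False using \<open>c * d < 4\<close> by simp
  qed
  then show ?thesis
  proof
    assume "c = 1"
    then show ?thesis using root_reflection_in[OF assms(1,2)] c by (simp add: root_reflection_def)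
  next
    assume "d = 1"
    then have "\<alpha> - \<delta> \<in> \<Phi>"
      using root_reflection_in[OF assms(2,1)] d by (simp add: root_reflection_def)
    then show ?thesis using root_uminus by fastforce
  qed
qed

text \<open>By reducedness \<open>- 2 *\<^sub>R \<delta>\<close> is not a root. The lemma ensures
  that no summand in a decomposition of a root is parallel to that root.\<close>

lemma root_add_distinct:
  assumes "\<delta> + \<epsilon> \<in> \<Phi>" "\<delta> \<in> \<Phi>" "\<epsilon> \<in> \<Phi>"
  shows "\<delta> \<noteq> \<delta> + \<epsilon>" "\<delta> \<noteq> - (\<delta> + \<epsilon>)"
proof -
  show "\<delta> \<noteq> \<delta> + \<epsilon>" using root_nonzero[OF assms(3)] by simp
  show "\<delta> \<noteq> - (\<delta> + \<epsilon>)"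
  proof
    assume "\<delta> = - (\<delta> + \<epsilon>)"
    then have "\<epsilon> = - (2 *\<^sub>R \<delta>)" by (simp add: algebra_simps scaleR_2 eq_neg_iff_add_eq_0)
    then have "(-2) *\<^sub>R \<delta> \<in> \<Phi>" using assms(3) by simp
    from root_in_span_root[OF assms(2) this] show False by simp
  qed
qed

lemma root_hyperplane_subset:
  assumes "\<alpha> \<in> \<Phi>" "\<delta> \<in> \<Phi>" "root_hyperplane \<alpha> j \<subseteq> root_hyperplane \<delta> m"
  shows "\<delta> = \<alpha> \<and> m = j \<or> \<delta> = - \<alpha> \<and> m = - j"
proof -
  have aa: "\<alpha> \<bullet> \<alpha> > 0" using root_nonzero assms by simp
  \<comment> \<open>\<open>x\<close> is the foot of the perpendicular from the origin and
    \<open>w\<close> the part of \<delta> orthogonal to \<alpha>. Both \<open>x\<close> and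
    \<open>x + w\<close> lie on the first hyperplane, which forces \<open>w = 0\<close>.\<close>
  define x where "x = (of_int j / (\<alpha> \<bullet> \<alpha>)) *\<^sub>R \<alpha>"
  define c where "c = (\<delta> \<bullet> \<alpha>) / (\<alpha> \<bullet> \<alpha>)"
  define w where "w = \<delta> - c *\<^sub>R \<alpha>"
  have wa: "w \<bullet> \<alpha> = 0" using aa by (simp add: w_def c_def inner_diff_left)
  have "x \<in> root_hyperplane \<alpha> j" "x + w \<in> root_hyperplane \<alpha> j"
    using aa wa by (simp_all add: root_hyperplane_def x_def inner_add_left)
  then have xd: "x \<bullet> \<delta> = of_int m" "(x + w) \<bullet> \<delta> = of_int m"
    using assms(3) by (auto simp: root_hyperplane_def)
  then have "w \<bullet> \<delta> = 0" by (simp add: inner_add_left)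
  then have "w \<bullet> w = 0" using wa by (simp add: w_def inner_diff_right)
  then have \<delta>: "\<delta> = c *\<^sub>R \<alpha>" by (simp add: w_def)
  have "x \<bullet> \<alpha> = of_int j" using aa by (simp add: x_def)
  then have "c * of_int j = of_int m" using xd(1) \<delta> by simp
  moreover have "c = 1 \<or> c = -1" using root_in_span_root[of \<alpha> c] assms \<delta> by simp
  ultimately have "c = 1 \<and> real_of_int m = of_int j \<or> c = -1 \<and> real_of_int m = of_int (- j)"
    by auto
  then show ?thesis using \<delta> by (auto simp only: of_int_eq_iff scaleR_one scaleR_minus1_left)
qed

section \<open>Simple affine roots and positivity\<close>

lemma generic_pos_or_neg:
  assumes "generic_point \<Phi> x" "\<delta> \<in> \<Phi>"
  shows "of_int m < x \<bullet> \<delta> \<or> of_int (- m) < x \<bullet> (- \<delta>)"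
proof -
  have "x \<bullet> \<delta> \<noteq> of_int m" using assms by (auto simp: generic_point_def)
  then show ?thesis by auto
qed

text \<open>If the difference were negative at \<open>x\<close>, its opposite would be positive
  there and, added to \<open>(\<delta>, m)\<close>, would decompose
  \<open>(\<alpha>, j)\<close>.\<close>

lemma simple_affine_root_diff:
  assumes "generic_point \<Phi> x" "simple_affine_root \<Phi> x \<alpha> j"
    and "\<delta> \<in> \<Phi>" "of_int m < x \<bullet> \<delta>" "\<delta> \<noteq> \<alpha>" "\<delta> \<bullet> \<alpha> > 0"
  shows "\<delta> - \<alpha> \<in> \<Phi>" "of_int (m - j) < x \<bullet> (\<delta> - \<alpha>)"
proof -
  have \<alpha>: "\<alpha> \<in> \<Phi>" using assms by (simp add: simple_affine_root_def)
  show d: "\<delta> - \<alpha> \<in> \<Phi>" by (rule root_diff) (use assms \<alpha> in auto)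
  show "of_int (m - j) < x \<bullet> (\<delta> - \<alpha>)"
  proof (rule ccontr)
    assume "\<not> ?thesis"
    then have "of_int (j - m) < x \<bullet> (\<alpha> - \<delta>)"
      using generic_pos_or_neg[OF assms(1) d, of "m - j"] by simp
    moreover have "\<alpha> - \<delta> \<in> \<Phi>" using root_uminus[OF d] by simp
    moreover have "\<alpha> = \<delta> + (\<alpha> - \<delta>)" "j = m + (j - m)" by simp_all
    ultimately show False using assms(2-4) unfolding simple_affine_root_def by blast
  qed
qed

text \<open>The point \<^term>\<open>z\<close> is obtained from \<^term>\<open>x\<close> by subtracting a nonnegative combination of
  \<^term>\<open>\<alpha>\<close> and \<^term>\<open>\<beta>\<close>. An affine root making an acute angle with \<^term>\<open>\<alpha>\<close> or \<^term>\<open>\<beta>\<close> stays positive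
  at \<^term>\<open>x\<close> after subtracting that simple affine root, so induction on its value at \<^term>\<open>x\<close> applies.
  Taking \<^term>\<open>\<alpha> = \<beta>\<close> gives the statement about a single wall.\<close>

lemma positive_affine_root_at_projection:
  assumes gen: "generic_point \<Phi> x"
    and \<alpha>: "simple_affine_root \<Phi> x \<alpha> j" and \<beta>: "simple_affine_root \<Phi> x \<beta> k"
    and z: "z \<bullet> \<alpha> = of_int j" "z \<bullet> \<beta> = of_int k"
    and obtuse: "\<And>\<delta>. \<delta> \<bullet> \<alpha> \<le> 0 \<Longrightarrow> \<delta> \<bullet> \<beta> \<le> 0 \<Longrightarrow> x \<bullet> \<delta> \<le> z \<bullet> \<delta>"
    and "\<delta> \<in> \<Phi>" "of_int m < x \<bullet> \<delta>"
  shows "of_int m < z \<bullet> \<delta> \<or>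
    (\<exists>a b::nat. \<delta> = of_nat a *\<^sub>R \<alpha> + of_nat b *\<^sub>R \<beta> \<and> m = int a * j + int b * k)"
proof -
  \<comment> \<open>Each subtraction of a simple affine root lowers the value at \<open>x\<close> by
    at least \<eta>, so \<open>N\<close> bounds the number of subtractions.\<close>
  define \<eta> where "\<eta> = min (x \<bullet> \<alpha> - of_int j) (x \<bullet> \<beta> - of_int k)"
  \<comment> \<open>Nonnegative combinations of the two simple affine roots vanish at
    \<open>z\<close>; they are the exceptions to strict positivity.\<close>
  define Q where "Q \<delta> m \<longleftrightarrow> (\<exists>a b::nat. \<delta> = of_nat a *\<^sub>R \<alpha> + of_nat b *\<^sub>R \<beta> \<and>
    m = int a * j + int b * k)" for \<delta> m
  have Q0: "Q 0 0" unfolding Q_def by (intro exI[of _ 0]) simp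
  have Q\<alpha>: "Q (\<delta> + \<alpha>) (m + j)" if "Q \<delta> m" for \<delta> m
  proof -
    from that obtain a b :: nat where "\<delta> = of_nat a *\<^sub>R \<alpha> + of_nat b *\<^sub>R \<beta>" "m = int a * j + int b * k"
      unfolding Q_def by blast
    then show ?thesis
      unfolding Q_def by (intro exI[of _ "Suc a"] exI[of _ b]) (simp add: algebra_simps)
  qed
  have Q\<beta>: "Q (\<delta> + \<beta>) (m + k)" if "Q \<delta> m" for \<delta> m
  proof -
    from that obtain a b :: nat where "\<delta> = of_nat a *\<^sub>R \<alpha> + of_nat b *\<^sub>R \<beta>" "m = int a * j + int b * k"
      unfolding Q_def by blast
    then show ?thesis
      unfolding Q_def by (intro exI[of _ a] exI[of _ "Suc b"]) (simp add: algebra_simps)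
  qed
  have \<eta>: "\<eta> > 0" using \<alpha> \<beta> by (simp add: \<eta>_def simple_affine_root_def)
  obtain N :: nat where "x \<bullet> \<delta> - of_int m < of_nat N * \<eta>"
    using reals_Archimedean3[OF \<eta>] by blast
  then have "of_int m < z \<bullet> \<delta> \<or> Q \<delta> m" using assms(7,8)
  proof (induction N arbitrary: \<delta> m)
    case (Suc N)
    have step: ?case if \<sigma>: "simple_affine_root \<Phi> x \<sigma> i" "z \<bullet> \<sigma> = of_int i" "\<eta> \<le> x \<bullet> \<sigma> - of_int i"
      and Q: "\<And>\<delta> m. Q \<delta> m \<Longrightarrow> Q (\<delta> + \<sigma>) (m + i)" and acute: "\<delta> \<bullet> \<sigma> > 0"
      for \<sigma> i
    proof (cases "\<delta> = \<sigma>")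
      \<comment> \<open>Here \<open>x \<bullet> \<sigma> < i + 1\<close> leaves
        \<open>m \<le> i\<close>: a smaller level is positive at \<open>z\<close>, and
        \<open>m = i\<close> is the simple affine root itself.\<close>
      case True
      then have "of_int m < (of_int (i + 1) :: real)" using \<sigma> Suc.prems by (simp add: simple_affine_root_def)
      then have "m < i \<or> m = i" by linarith
      then show ?thesis using True \<sigma>(2) Q[OF Q0] by auto
    next
      case False
      note d = simple_affine_root_diff[OF gen \<sigma>(1) Suc.prems(2,3) False acute]
      have "x \<bullet> (\<delta> - \<sigma>) - of_int (m - i) < of_nat N * \<eta>"
        using Suc.prems(1) \<sigma>(3) by (simp add: algebra_simps)
      from Suc.IH[OF this d] show ?thesis
      proof
        assume "of_int (m - i) < z \<bullet> (\<delta> - \<sigma>)"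
        then show ?thesis by (simp add: \<sigma>(2) inner_diff_right)
      qed (use Q in fastforce)
    qed
    consider "\<delta> \<bullet> \<alpha> > 0" | "\<delta> \<bullet> \<beta> > 0" | "\<delta> \<bullet> \<alpha> \<le> 0" "\<delta> \<bullet> \<beta> \<le> 0" by linarith
    then show ?case
    proof cases
      case 1
      show ?thesis by (rule step[OF \<alpha> z(1) _ Q\<alpha> 1]) (simp_all add: \<eta>_def)
    next
      case 2
      show ?thesis by (rule step[OF \<beta> z(2) _ Q\<beta> 2]) (simp_all add: \<eta>_def)
    next
      case 3
      then show ?thesis using obtuse[of \<delta>] Suc.prems(3) by auto
    qed
  qed simp
  then show ?thesis unfolding Q_def .
qed


section \<open>Rotation about a face and descent towards the minimal alcove\<close>

lemma dual_basis:
  assumes "\<alpha> \<in> \<Phi>" "\<beta> \<in> \<Phi>" "\<beta> \<noteq> \<alpha>" "\<beta> \<noteq> - \<alpha>" "\<alpha> \<bullet> \<beta> \<le> 0"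
  obtains f g where "f \<bullet> \<alpha> = 1" "f \<bullet> \<beta> = 0" "g \<bullet> \<alpha> = 0" "g \<bullet> \<beta> = 1"
    "\<And>\<delta>. \<delta> \<bullet> \<alpha> \<le> 0 \<Longrightarrow> \<delta> \<bullet> \<beta> \<le> 0 \<Longrightarrow> f \<bullet> \<delta> \<le> 0 \<and> g \<bullet> \<delta> \<le> 0"
proof -
  define D where "D = (\<alpha> \<bullet> \<alpha>) * (\<beta> \<bullet> \<beta>) - (\<alpha> \<bullet> \<beta>)\<^sup>2"
  have D: "D > 0" using inner_square_less[OF assms(1-4)] by (simp add: D_def)
  \<comment> \<open>The basis of the plane dual to \<alpha>, \<beta>, from the inverse Gram matrix.
    As \<open>\<alpha> \<bullet> \<beta> \<le> 0\<close>, its entries are nonnegative, so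
    \<open>f\<close> and \<open>g\<close> are nonnegative combinations of \<alpha> and
    \<beta>.\<close>
  define f where "f = (1 / D) *\<^sub>R ((\<beta> \<bullet> \<beta>) *\<^sub>R \<alpha> - (\<alpha> \<bullet> \<beta>) *\<^sub>R \<beta>)"
  define g where "g = (1 / D) *\<^sub>R ((\<alpha> \<bullet> \<alpha>) *\<^sub>R \<beta> - (\<alpha> \<bullet> \<beta>) *\<^sub>R \<alpha>)"
  show ?thesis
  proof (rule that[of f g])
    have ne: "D \<noteq> 0" using D by simp
    show "f \<bullet> \<alpha> = 1" "f \<bullet> \<beta> = 0" "g \<bullet> \<alpha> = 0" "g \<bullet> \<beta> = 1"
      using ne by (simp_all add: f_def g_def inner_diff_left inner_commute[of \<beta> \<alpha>])
        (simp_all add: D_def power2_eq_square mult.commute)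
    fix \<delta> assume \<delta>: "\<delta> \<bullet> \<alpha> \<le> 0" "\<delta> \<bullet> \<beta> \<le> 0"
    have "(\<beta> \<bullet> \<beta>) * (\<delta> \<bullet> \<alpha>) \<le> 0" "(\<alpha> \<bullet> \<alpha>) * (\<delta> \<bullet> \<beta>) \<le> 0"
      "(\<alpha> \<bullet> \<beta>) * (\<delta> \<bullet> \<alpha>) \<ge> 0" "(\<alpha> \<bullet> \<beta>) * (\<delta> \<bullet> \<beta>) \<ge> 0"
      using \<delta> assms(5) by (simp_all add: mult_nonneg_nonpos mult_nonpos_nonpos)
    then have "(1 / D) * ((\<beta> \<bullet> \<beta>) * (\<delta> \<bullet> \<alpha>) - (\<alpha> \<bullet> \<beta>) * (\<delta> \<bullet> \<beta>)) \<le> 0"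
      "(1 / D) * ((\<alpha> \<bullet> \<alpha>) * (\<delta> \<bullet> \<beta>) - (\<alpha> \<bullet> \<beta>) * (\<delta> \<bullet> \<alpha>)) \<le> 0"
      using D by (intro mult_nonneg_nonpos; simp)+
    then show "f \<bullet> \<delta> \<le> 0 \<and> g \<bullet> \<delta> \<le> 0"
      by (simp add: f_def g_def inner_diff_left inner_diff_right inner_commute[of _ \<delta>])
  qed
qed

text \<open>Applied to negated roots, \<open>sub\<close> shows that the same affine roots are
  positive at \<open>x\<close> and \<open>p\<close>, so both points lie in one alcove.\<close>

lemma simple_affine_root_transfer:
  assumes "generic_point \<Phi> x" "generic_point \<Phi> p" "simple_affine_root \<Phi> x \<alpha> j"
    and sub: "\<And>\<delta> m. \<delta> \<in> \<Phi> \<Longrightarrow> of_int m < x \<bullet> \<delta> \<Longrightarrow> of_int m < p \<bullet> \<delta>"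
  shows "simple_affine_root \<Phi> p \<alpha> j"
proof -
  have conv: "of_int m < x \<bullet> \<delta>" if "\<delta> \<in> \<Phi>" "of_int m < p \<bullet> \<delta>" for \<delta> m
    using generic_pos_or_neg[OF assms(1) that(1), of m] sub[OF root_uminus[OF that(1)], of "- m"] that(2)
    by auto
  have \<alpha>: "\<alpha> \<in> \<Phi>" "of_int j < x \<bullet> \<alpha>" "x \<bullet> \<alpha> < of_int j + 1"
    using assms(3) by (auto simp: simple_affine_root_def)
  have "p \<bullet> \<alpha> < of_int j + 1"
    using sub[OF root_uminus[OF \<alpha>(1)], of "- (j + 1)"] \<alpha>(3) by simp
  then show ?thesis
    using assms(3) sub conv \<alpha> unfolding simple_affine_root_def by blast
qed

lemma finite_separating_roots: "finite (separating_roots \<Phi> x p)"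
proof (rule finite_subset)
  show "separating_roots \<Phi> x p \<subseteq> (SIGMA \<delta>:\<Phi>. {\<lfloor>p \<bullet> \<delta>\<rfloor>..\<lceil>x \<bullet> \<delta>\<rceil>})"
    unfolding separating_roots_def by (auto; linarith)
qed (simp add: finite_roots)

text \<open>Among the affine roots separating \<^term>\<open>x\<close> from \<^term>\<open>p\<close>, one with least value at \<^term>\<open>x\<close> is
  indecomposable, since one summand of a decomposition would separate as well.\<close>

lemma exists_simple_separating:
  assumes x: "generic_point \<Phi> x"
    and ne: "separating_roots \<Phi> x p \<noteq> {}"
  obtains \<beta> k where "simple_affine_root \<Phi> x \<beta> k" "p \<bullet> \<beta> < of_int k"
proof -
  define f where "f = (\<lambda>(\<delta>, m::int). x \<bullet> \<delta> - of_int m)"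
  obtain s where s: "s \<in> separating_roots \<Phi> x p" "\<And>t. t \<in> separating_roots \<Phi> x p \<Longrightarrow> f s \<le> f t"
    using ex_is_arg_min_if_finite[OF finite_separating_roots ne, of f] by (auto simp: is_arg_min_linorder)
  obtain \<beta> k where bk: "s = (\<beta>, k)" by (cases s)
  have b: "\<beta> \<in> \<Phi>" "of_int k < x \<bullet> \<beta>" "p \<bullet> \<beta> < of_int k" using s bk by (auto simp: separating_roots_def)
  have min: "x \<bullet> \<beta> - of_int k \<le> x \<bullet> \<delta> - of_int m"
    if "\<delta> \<in> \<Phi>" "of_int m < x \<bullet> \<delta>" "p \<bullet> \<delta> < of_int m" for \<delta> m
    using s(2)[of "(\<delta>, m)"] that by (simp add: bk f_def separating_roots_def)
  have "simple_affine_root \<Phi> x \<beta> k"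
    unfolding simple_affine_root_def
  proof (intro conjI b notI)
    \<comment> \<open>Otherwise \<open>(\<beta>, k + 1)\<close> would also separate, with a smaller
      value at \<open>x\<close>.\<close>
    show "x \<bullet> \<beta> < of_int k + 1"
    proof (rule ccontr)
      assume a: "\<not> ?thesis"
      moreover have "x \<bullet> \<beta> \<noteq> of_int (k + 1)" using x b by (auto simp: generic_point_def)
      ultimately have "of_int (k + 1) < x \<bullet> \<beta>" by simp
      then show False using min[of \<beta> "k + 1"] b by simp
    qed
    assume "\<exists>\<delta> \<epsilon> m n. \<delta> \<in> \<Phi> \<and> \<epsilon> \<in> \<Phi> \<and> \<beta> = \<delta> + \<epsilon> \<and> k = m + n \<and>
        of_int m < x \<bullet> \<delta> \<and> of_int n < x \<bullet> \<epsilon>"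
    then obtain \<delta> \<epsilon> m n where d: "\<delta> \<in> \<Phi>" "\<epsilon> \<in> \<Phi>" "\<beta> = \<delta> + \<epsilon>" "k = m + n"
        "of_int m < x \<bullet> \<delta>" "of_int n < x \<bullet> \<epsilon>" by blast
    have "p \<bullet> \<delta> < of_int m \<or> p \<bullet> \<epsilon> < of_int n"
      using b(3) d by (auto simp: inner_add_right)
    then show False
      using min[of \<delta> m] min[of \<epsilon> n] d by (auto simp: inner_add_right)
  qed
  then show ?thesis using that b by blast
qed

text \<open>At an acute angle the difference would be an affine root positive at \<open>x\<close>
  and would decompose \<open>(\<beta>, k)\<close>.\<close>

lemma simple_roots_obtuse:
  assumes "generic_point \<Phi> x" "simple_affine_root \<Phi> x \<alpha> j" "simple_affine_root \<Phi> x \<beta> k" "\<alpha> \<noteq> \<beta>"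
  shows "\<alpha> \<bullet> \<beta> \<le> 0"
proof (rule ccontr)
  assume "\<not> ?thesis"
  then have pos: "\<beta> \<bullet> \<alpha> > 0" by (simp add: inner_commute)
  have \<beta>: "\<beta> \<in> \<Phi>" "of_int k < x \<bullet> \<beta>" and \<alpha>: "\<alpha> \<in> \<Phi>" "of_int j < x \<bullet> \<alpha>"
    using assms by (auto simp: simple_affine_root_def)
  note d = simple_affine_root_diff[OF assms(1,2) \<beta> assms(4)[symmetric] pos]
  have "\<beta> = \<alpha> + (\<beta> - \<alpha>)" "k = j + (k - j)" by simp_all
  then show False using assms(3) \<alpha> d unfolding simple_affine_root_def by blast
qed

text \<open>The sector opposite to \<^term>\<open>x\<close> at the codimension-two face where the walls \<^term>\<open>(\<alpha>, j)\<close> and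
  \<^term>\<open>(\<beta>, k)\<close> meet, on the same side of the first wall. Every affine root changing sign on the way
  there is a combination of the two with a positive coefficient at \<^term>\<open>(\<beta>, k)\<close>.\<close>

lemma rotate_about_face:
  assumes gen: "generic_point \<Phi> x"
    and \<alpha>: "simple_affine_root \<Phi> x \<alpha> j" and \<beta>: "simple_affine_root \<Phi> x \<beta> k"
    and ne: "\<beta> \<noteq> \<alpha>" "\<beta> \<noteq> - \<alpha>"
  obtains y where "generic_point \<Phi> y" "simple_affine_root \<Phi> y \<alpha> j" "y \<bullet> \<beta> < of_int k"
    "\<And>\<delta> m. \<delta> \<in> \<Phi> \<Longrightarrow> of_int m < x \<bullet> \<delta> \<Longrightarrow> of_int m < y \<bullet> \<delta> \<or>
      (\<exists>a b::nat. b > 0 \<and> \<delta> = of_nat a *\<^sub>R \<alpha> + of_nat b *\<^sub>R \<beta> \<and> m = int a * j + int b * k)"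
proof -
  have \<alpha>': "\<alpha> \<in> \<Phi>" "of_int j < x \<bullet> \<alpha>" "x \<bullet> \<alpha> < of_int j + 1"
    and \<beta>': "\<beta> \<in> \<Phi>" "of_int k < x \<bullet> \<beta>"
    using \<alpha> \<beta> by (auto simp: simple_affine_root_def)
  obtain f g where fg: "f \<bullet> \<alpha> = 1" "f \<bullet> \<beta> = 0" "g \<bullet> \<alpha> = 0" "g \<bullet> \<beta> = 1"
    and fg_le: "\<And>\<delta>. \<delta> \<bullet> \<alpha> \<le> 0 \<Longrightarrow> \<delta> \<bullet> \<beta> \<le> 0 \<Longrightarrow> f \<bullet> \<delta> \<le> 0 \<and> g \<bullet> \<delta> \<le> 0"
    using dual_basis[OF \<alpha>'(1) \<beta>'(1) ne simple_roots_obtuse[OF gen \<alpha> \<beta> ne(1)[symmetric]]] by metis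
  \<comment> \<open>The orthogonal projection of \<open>x\<close> to the codimension-two flat where
    both simple affine roots vanish.\<close>
  define z where "z = x - (x \<bullet> \<alpha> - of_int j) *\<^sub>R f - (x \<bullet> \<beta> - of_int k) *\<^sub>R g"
  define comb where "comb \<delta> m a b \<longleftrightarrow>
    \<delta> = of_nat a *\<^sub>R \<alpha> + of_nat b *\<^sub>R \<beta> \<and> m = int a * j + int b * k" for \<delta> m a b
  have z: "z \<bullet> \<alpha> = of_int j" "z \<bullet> \<beta> = of_int k"
    using fg by (simp_all add: z_def inner_diff_left)
  have "x \<bullet> \<delta> \<le> z \<bullet> \<delta>" if "\<delta> \<bullet> \<alpha> \<le> 0" "\<delta> \<bullet> \<beta> \<le> 0" for \<delta>
    using fg_le[OF that] \<alpha>'(2) \<beta>'(2)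
      mult_nonneg_nonpos[of "x \<bullet> \<alpha> - of_int j" "f \<bullet> \<delta>"] mult_nonneg_nonpos[of "x \<bullet> \<beta> - of_int k" "g \<bullet> \<delta>"]
    by (simp add: z_def inner_diff_left)
  then have dich: "of_int m < z \<bullet> \<delta> \<or> (\<exists>a b. comb \<delta> m a b)" if "\<delta> \<in> \<Phi>" "of_int m < x \<bullet> \<delta>" for \<delta> m
    unfolding comb_def using positive_affine_root_at_projection[OF gen \<alpha> \<beta> z _ that] by blast
  have comb_z: "z \<bullet> \<delta> = of_int m" if "comb \<delta> m a b" for \<delta> m a b
    using that z by (simp add: comb_def inner_add_right)

  \<comment> \<open>On a combination, \<open>f\<close> and \<open>g\<close> read off the
    coefficients \<open>a\<close> and \<open>b\<close>. With \<open>\<tau> * a < 1\<close> for all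
    roots, the direction \<open>\<tau> *\<^sub>R f - g\<close> is positive on \<alpha> but negative
    on every combination with \<open>b > 0\<close>.\<close>
  have "\<forall>\<^sub>F \<tau> in at_right (0::real). \<tau> * (f \<bullet> \<delta>) < 1" for \<delta>
    by (rule order_tendstoD(2)[where y = "0 * (f \<bullet> \<delta>)"]) (intro tendsto_intros, simp)
  then have "\<forall>\<^sub>F \<tau> in at_right (0::real). \<forall>\<delta>\<in>\<Phi>. \<tau> * (f \<bullet> \<delta>) < 1"
    by (intro eventually_ball_finite finite_roots) auto
  moreover have "\<forall>\<^sub>F \<tau> in at_right (0::real). 0 < \<tau>" by (simp add: eventually_at_right_less)
  ultimately have "\<forall>\<^sub>F \<tau> in at_right (0::real). 0 < \<tau> \<and> (\<forall>\<delta>\<in>\<Phi>. \<tau> * (f \<bullet> \<delta>) < 1)"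
    by eventually_elim simp
  then obtain \<tau> :: real where \<tau>: "0 < \<tau>" "\<And>\<delta>. \<delta> \<in> \<Phi> \<Longrightarrow> \<tau> * (f \<bullet> \<delta>) < 1"
    using eventually_happens'[OF trivial_limit_at_right_real] by blast
  define d where "d = \<tau> *\<^sub>R f - g"
  have comb_d: "d \<bullet> \<delta> < 0" if "comb \<delta> m a b" "\<delta> \<in> \<Phi>" "b > 0" for \<delta> m a b
  proof -
    have "d \<bullet> \<delta> = \<tau> * (f \<bullet> \<delta>) - of_nat b"
      using that(1) fg by (simp add: comb_def d_def inner_diff_left inner_add_right)
    moreover have "of_nat b \<ge> (1::real)" using that(3) by simp
    ultimately show ?thesis using \<tau>(2)[OF that(2)] by linarith
  qed

  have "\<forall>\<^sub>F t in at_right (0::real). 0 < t" by (simp add: eventually_at_right_less)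
  with eventually_near_ray[OF finite_roots, of z d]
  have "\<forall>\<^sub>F t in at_right 0. 0 < t \<and>
    (\<forall>\<delta>\<in>\<Phi>. \<forall>m::int. of_int m < z \<bullet> \<delta> \<longrightarrow> of_int m < (z + t *\<^sub>R d) \<bullet> \<delta>)"
    by eventually_elim simp
  then obtain t where t: "0 < t"
    "\<And>\<delta> m. \<delta> \<in> \<Phi> \<Longrightarrow> of_int m < z \<bullet> \<delta> \<Longrightarrow> of_int m < (z + t *\<^sub>R d) \<bullet> \<delta>"
    using eventually_happens'[OF trivial_limit_at_right_real] by blast
  define y where "y = z + t *\<^sub>R d"
  have comb_y: "y \<bullet> \<delta> < of_int m" if "comb \<delta> m a b" "\<delta> \<in> \<Phi>" "b > 0" for \<delta> m a b
    using comb_d[OF that] comb_z[OF that(1)] t(1) by (simp add: y_def inner_add_left mult_pos_neg)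
  have sign: "of_int m < y \<bullet> \<delta> \<or> (\<exists>a b. b > 0 \<and> comb \<delta> m a b)" if \<delta>: "\<delta> \<in> \<Phi>" "of_int m < x \<bullet> \<delta>" for \<delta> m
    using dich[OF \<delta>]
  proof (elim disjE exE)
    assume "of_int m < z \<bullet> \<delta>"
    then show ?thesis using t(2) \<delta>(1) by (auto simp: y_def)
  next
    fix a b assume c: "comb \<delta> m a b"
    show ?thesis
    proof (cases "b = 0")
      case True
      then have "\<delta> = of_nat a *\<^sub>R \<alpha>" using c by (simp add: comb_def)
      moreover from this have "a > 0" using root_nonzero[OF \<delta>(1)] by (cases a) auto
      ultimately have "d \<bullet> \<delta> > 0" using fg \<tau>(1) by (simp add: d_def inner_diff_left)
      then show ?thesis using comb_z[OF c] t(1) by (simp add: y_def inner_add_left)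
    qed (use c in blast)
  qed
  have gen_y: "generic_point \<Phi> y"
    unfolding generic_point_def
  proof (intro ballI notI)
    fix \<delta> assume \<delta>: "\<delta> \<in> \<Phi>" and "y \<bullet> \<delta> \<in> \<int>"
    then obtain m where m: "y \<bullet> \<delta> = of_int m" by (auto elim: Ints_cases)
    from generic_pos_or_neg[OF gen \<delta>, of m] show False
      using sign[OF \<delta>, of m] sign[OF root_uminus[OF \<delta>], of "- m"]
        comb_y[OF _ \<delta>, of m] comb_y[OF _ root_uminus[OF \<delta>], of "- m"] m by fastforce
  qed
  have flip: "\<exists>a b. b > 0 \<and> comb (- \<delta>) (- m) a b"
    if "\<delta> \<in> \<Phi>" "of_int m < y \<bullet> \<delta>" "\<not> of_int m < x \<bullet> \<delta>" for \<delta> m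
    using generic_pos_or_neg[OF gen that(1), of m] sign[OF root_uminus[OF that(1)], of "- m"] that(2,3)
    by auto
  have "simple_affine_root \<Phi> y \<alpha> j"
    unfolding simple_affine_root_def
  proof (intro conjI notI)
    show "\<alpha> \<in> \<Phi>" by fact
    have "d \<bullet> \<alpha> = \<tau>" using fg by (simp add: d_def inner_diff_left)
    then show "of_int j < y \<bullet> \<alpha>" using z(1) t(1) \<tau>(1) by (simp add: y_def inner_add_left)
    show "y \<bullet> \<alpha> < of_int j + 1"
      using t(2)[OF root_uminus[OF \<alpha>'(1)], of "- (j + 1)"] z(1) by (simp add: y_def)
    assume "\<exists>\<delta> \<epsilon> m n. \<delta> \<in> \<Phi> \<and> \<epsilon> \<in> \<Phi> \<and> \<alpha> = \<delta> + \<epsilon> \<and> j = m + n \<and>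
        of_int m < y \<bullet> \<delta> \<and> of_int n < y \<bullet> \<epsilon>"
    then obtain \<delta> \<epsilon> m n where dec: "\<delta> \<in> \<Phi>" "\<epsilon> \<in> \<Phi>" "\<alpha> = \<delta> + \<epsilon>" "j = m + n"
      "of_int m < y \<bullet> \<delta>" "of_int n < y \<bullet> \<epsilon>" by blast
    \<comment> \<open>If \<open>(\<delta>, m)\<close> were not positive at \<open>x\<close>, its
      opposite would be a combination with \<open>b > 0\<close>. Adding \<open>(\<alpha>, j)\<close>
      makes \<open>(\<epsilon>, n)\<close> such a combination too, hence negative at
      \<open>y\<close>. So a decomposition at \<open>y\<close> is already one at
      \<open>x\<close>.\<close>
    have kept: "of_int m < x \<bullet> \<delta>" if dec: "\<delta> \<in> \<Phi>" "\<epsilon> \<in> \<Phi>" "\<alpha> = \<delta> + \<epsilon>" "j = m + n"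
      "of_int m < y \<bullet> \<delta>" "of_int n < y \<bullet> \<epsilon>" for \<delta> \<epsilon> m n
    proof (rule ccontr)
      assume "\<not> ?thesis"
      then obtain a b where c: "b > 0" "comb (- \<delta>) (- m) a b" using flip dec by blast
      have e: "\<epsilon> = \<alpha> + - \<delta>" "n = j + - m" using dec(3,4) by simp_all
      have "- \<delta> = of_nat a *\<^sub>R \<alpha> + of_nat b *\<^sub>R \<beta>" "- m = int a * j + int b * k"
        using c(2) by (simp_all add: comb_def)
      then have "comb \<epsilon> n (Suc a) b" unfolding comb_def e by (simp add: algebra_simps)
      from comb_y[OF this dec(2) c(1)] dec(6) show False by simp
    qed
    have "of_int m < x \<bullet> \<delta>" by (rule kept[OF dec])
    moreover have "of_int n < x \<bullet> \<epsilon>"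
      by (rule kept[of \<epsilon> \<delta> n m]) (use dec in \<open>simp_all add: add.commute\<close>)
    ultimately show False using \<alpha> dec unfolding simple_affine_root_def by blast
  qed
  moreover have "y \<bullet> \<beta> < of_int k"
    by (rule comb_y[OF _ \<beta>'(1), of k 0 1]) (simp_all add: comb_def)
  ultimately show ?thesis using that gen_y sign unfolding comb_def by blast
qed


text \<open>The set \<^term>\<open>R\<close> stands for a Shi region and \<^term>\<open>p\<close> for a point of its minimal alcove. Rotating
  about a face as above moves \<^term>\<open>x\<close> inside \<^term>\<open>R\<close> and strictly closer to \<^term>\<open>p\<close>: by minimality, no
  affine root that becomes negative on the way is positive at \<^term>\<open>p\<close>.\<close>

lemma simple_affine_root_descent:
  assumes P: "P \<subseteq> \<Phi>" "\<And>\<delta>. \<delta> \<in> \<Phi> \<Longrightarrow> \<delta> \<in> P \<or> - \<delta> \<in> P"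
    and same: "\<And>x y \<delta> m. x \<in> R \<Longrightarrow> y \<in> R \<Longrightarrow> \<delta> \<in> P \<Longrightarrow> m \<in> {0, 1::int} \<Longrightarrow>
      of_int m < x \<bullet> \<delta> \<longleftrightarrow> of_int m < y \<bullet> \<delta>"
    and mem: "\<And>x y. x \<in> R \<Longrightarrow> generic_point \<Phi> y \<Longrightarrow>
      (\<And>\<delta> m. \<delta> \<in> P \<Longrightarrow> m \<in> {0, 1::int} \<Longrightarrow> of_int m < x \<bullet> \<delta> \<longleftrightarrow> of_int m < y \<bullet> \<delta>) \<Longrightarrow> y \<in> R"
    and min: "\<And>y \<delta> m. y \<in> R \<Longrightarrow> generic_point \<Phi> y \<Longrightarrow> \<delta> \<in> \<Phi> \<Longrightarrow> m \<ge> (1::int) \<Longrightarrow>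
      of_int m < p \<bullet> \<delta> \<Longrightarrow> of_int m < y \<bullet> \<delta>"
    and p: "p \<in> R" "generic_point \<Phi> p"
    and \<alpha>: "\<alpha> \<in> P"
    and "x \<in> R" "generic_point \<Phi> x" "simple_affine_root \<Phi> x \<alpha> 1"
  shows "simple_affine_root \<Phi> p \<alpha> 1"
  using assms(9-11)
proof (induction "card (separating_roots \<Phi> x p)" arbitrary: x rule: less_induct)
  case less
  note x = less.prems
  show ?case
  proof (cases "separating_roots \<Phi> x p = {}")
    case True
    have "of_int m < p \<bullet> \<delta>" if "\<delta> \<in> \<Phi>" "of_int m < x \<bullet> \<delta>" for \<delta> m
    proof -
      have "\<not> p \<bullet> \<delta> < of_int m" using True that by (auto simp: separating_roots_def)
      moreover have "p \<bullet> \<delta> \<noteq> of_int m" using p(2) that(1) by (auto simp: generic_point_def)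
      ultimately show ?thesis by simp
    qed
    then show ?thesis by (rule simple_affine_root_transfer[OF x(2) p(2) x(3)])
  next
    case False
    obtain \<beta> k where \<beta>: "simple_affine_root \<Phi> x \<beta> k" "p \<bullet> \<beta> < of_int k"
      using exists_simple_separating[OF x(2) False] by metis
    have \<beta>': "\<beta> \<in> \<Phi>" "of_int k < x \<bullet> \<beta>" using \<beta> by (auto simp: simple_affine_root_def)
    have \<alpha>': "1 < x \<bullet> \<alpha>" "x \<bullet> \<alpha> < 2" using x(3) by (auto simp: simple_affine_root_def)
    \<comment> \<open>Level 0 hyperplanes are Shi hyperplanes, and none of these separates two
      points of \<open>R\<close>.\<close>
    have k_ne_0: "k \<noteq> 0"
    proof
      assume k: "k = 0"
      have "- \<beta> \<notin> P"
        using same[OF x(1) p(1), of "- \<beta>" 0] \<beta>'(2) \<beta>(2) k by auto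
      moreover have "\<beta> \<notin> P" using same[OF x(1) p(1), of \<beta> 0] \<beta>'(2) \<beta>(2) k by auto
      ultimately show False using P(2)[OF \<beta>'(1)] by blast
    qed
    \<comment> \<open>For \<open>k < 0\<close> the opposite affine root has level at least 1 and is
      positive at \<open>p\<close>, so minimality would make it positive at
      \<open>x\<close>.\<close>
    have "\<not> k < 0"
      using min[OF x(1,2) root_uminus[OF \<beta>'(1)], of "- k"] \<beta>'(2) \<beta>(2) by auto
    with k_ne_0 have k: "k \<ge> 1" by linarith
    have k1: "\<beta> \<notin> P" if "k = 1"
      using same[OF x(1) p(1), of \<beta> k] \<beta>'(2) \<beta>(2) that by auto
    have "\<beta> \<noteq> \<alpha>"
    proof
      assume "\<beta> = \<alpha>"
      then have "of_int k < (of_int 2 :: real)" using \<alpha>'(2) \<beta>'(2) by simp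
      then have "k = 1" using k by linarith
      then show False using k1 \<alpha> \<open>\<beta> = \<alpha>\<close> by simp
    qed
    moreover have "\<beta> \<noteq> - \<alpha>"
    proof
      assume "\<beta> = - \<alpha>"
      then have "of_int k < (of_int 0 :: real)" using \<alpha>'(1) \<beta>'(2) by simp
      then show False using k by linarith
    qed
    ultimately obtain y where y: "generic_point \<Phi> y" "simple_affine_root \<Phi> y \<alpha> 1" "y \<bullet> \<beta> < of_int k"
      and flip: "\<And>\<delta> m. \<delta> \<in> \<Phi> \<Longrightarrow> of_int m < x \<bullet> \<delta> \<Longrightarrow> of_int m < y \<bullet> \<delta> \<or>
        (\<exists>a b::nat. b > 0 \<and> \<delta> = of_nat a *\<^sub>R \<alpha> + of_nat b *\<^sub>R \<beta> \<and> m = int a * 1 + int b * k)"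
      using rotate_about_face[OF x(2,3) \<beta>(1)] by metis
    have bk: "int b * k \<ge> int b" for b using mult_left_mono[OF k, of "int b"] by simp
    \<comment> \<open>An affine root that changes sign is a combination with \<open>b > 0\<close>;
      since 1 and \<open>k\<close> are at least 1, so is its level.\<close>
    have flip_pos: "m \<ge> 1" if \<delta>: "\<delta> \<in> \<Phi>" "of_int m < x \<bullet> \<delta>" "\<not> of_int m < y \<bullet> \<delta>" for \<delta> m
    proof -
      obtain a b :: nat where "b > 0" "m = int a * 1 + int b * k"
        using flip[OF \<delta>(1,2)] \<delta>(3) by blast
      then show ?thesis using bk[of b] by linarith
    qed
    have yR: "y \<in> R"
    proof (rule mem[OF x(1) y(1)])
      fix \<delta> and m :: int assume \<delta>: "\<delta> \<in> P" and m: "m \<in> {0, 1}"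
      have \<delta>\<Phi>: "\<delta> \<in> \<Phi>" using P(1) \<delta> by blast
      have "of_int m < y \<bullet> \<delta>" if less: "of_int m < x \<bullet> \<delta>"
      proof (rule ccontr)
        assume "\<not> ?thesis"
        then obtain a b :: nat where ab: "b > 0" "\<delta> = of_nat a *\<^sub>R \<alpha> + of_nat b *\<^sub>R \<beta>" "m = int a + int b * k"
          using flip[OF \<delta>\<Phi> less] by auto
        \<comment> \<open>Level at most 1 leaves only \<open>(\<beta>, k)\<close> itself with
          \<open>k = 1\<close>, where \<beta> is not a positive root.\<close>
        have "m \<le> 1" using m by auto
        with ab(1,3) bk[of b] have "a = 0 \<and> b = 1" by linarith
        then have "k = 1" "\<delta> = \<beta>" using ab m k by auto
        then show False using k1 \<delta> by simp
      qed
      moreover have "of_int m < x \<bullet> \<delta>" if "of_int m < y \<bullet> \<delta>"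
      proof (rule ccontr)
        assume "\<not> ?thesis"
        then have "of_int (- m) < x \<bullet> (- \<delta>)" using generic_pos_or_neg[OF x(2) \<delta>\<Phi>, of m] by blast
        from flip_pos[OF root_uminus[OF \<delta>\<Phi>] this] show False using that m by auto
      qed
      ultimately show "of_int m < x \<bullet> \<delta> \<longleftrightarrow> of_int m < y \<bullet> \<delta>" by blast
    qed
    have "separating_roots \<Phi> y p \<subset> separating_roots \<Phi> x p"
    proof (rule psubsetI)
      show "separating_roots \<Phi> y p \<subseteq> separating_roots \<Phi> x p"
      proof
        fix e assume "e \<in> separating_roots \<Phi> y p"
        then obtain \<delta> m where e: "e = (\<delta>, m)" "\<delta> \<in> \<Phi>" "of_int m < y \<bullet> \<delta>" "p \<bullet> \<delta> < of_int m"
          by (auto simp: separating_roots_def)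
        \<comment> \<open>Otherwise the opposite affine root turns negative on the way to
          \<open>y\<close>, so it has level at least 1; being positive at \<open>p\<close>, it is
          positive at \<open>y\<close> by minimality.\<close>
        have "of_int m < x \<bullet> \<delta>"
        proof (rule ccontr)
          assume "\<not> ?thesis"
          then have "of_int (- m) < x \<bullet> (- \<delta>)" using generic_pos_or_neg[OF x(2) e(2), of m] by blast
          then have "- m \<ge> 1" using flip_pos[OF root_uminus[OF e(2)], of "- m"] e(3) by simp
          then have "of_int (- m) < y \<bullet> (- \<delta>)"
            by (rule min[OF yR y(1) root_uminus[OF e(2)]]) (use e in simp)
          then show False using e(3) by simp
        qed
        then show "e \<in> separating_roots \<Phi> x p" using e by (simp add: separating_roots_def)
      qed
      have "(\<beta>, k) \<in> separating_roots \<Phi> x p" "(\<beta>, k) \<notin> separating_roots \<Phi> y p"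
        using \<beta>' \<beta>(2) y(3) by (auto simp: separating_roots_def)
      then show "separating_roots \<Phi> y p \<noteq> separating_roots \<Phi> x p" by blast
    qed
    then have "card (separating_roots \<Phi> y p) < card (separating_roots \<Phi> x p)"
      by (rule psubset_card_mono[OF finite_separating_roots])
    then show ?thesis by (rule less.hyps[OF _ yR y(1,2)])
  qed
qed

end

subsection \<open>Regions and their facets\<close>

lemma closure_inner_ge:
  fixes a :: "'a::euclidean_space"
  assumes "\<And>y. y \<in> S \<Longrightarrow> c < y \<bullet> a" "f \<in> closure S"
  shows "c \<le> f \<bullet> a"
proof -
  have "closure S \<subseteq> {y. a \<bullet> y \<ge> c}"
    using assms(1) by (intro closure_minimal closed_halfspace_ge) (auto simp: inner_commute less_imp_le)
  then show ?thesis using assms(2) by (auto simp: inner_commute)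
qed

text \<open>The half ball puts a flat disc around \<open>h\<close> into the closure, so the
  intersection has the dimension of the hyperplane; it is a face because the hyperplane supports the
  closure.\<close>

lemma half_ball_facet:
  fixes a :: "'a::euclidean_space"
  assumes conv: "convex S" and side: "\<And>y. y \<in> S \<Longrightarrow> c < y \<bullet> a" and "a \<noteq> 0" and h: "h \<bullet> a = c"
    and "e > 0" and sub: "ball h e \<inter> {y. c < y \<bullet> a} \<subseteq> S"
  shows "({x. x \<bullet> a = c} \<inter> closure S) facet_of closure S"
proof -
  have aa: "a \<bullet> a > 0" using \<open>a \<noteq> 0\<close> by simp
  have near: "y \<in> closure (ball h e \<inter> {y. c < y \<bullet> a})" "ball h e \<inter> {y. c < y \<bullet> a} \<noteq> {}"
    if "y \<in> ball h e" "y \<bullet> a = c" for y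
  proof -
    have "\<forall>\<^sub>F t in at_right (0::real). y + t *\<^sub>R a \<in> ball h e"
      by (rule topological_tendstoD[OF tendsto_ray]) (use that in auto)
    moreover have "\<forall>\<^sub>F t in at_right (0::real). 0 < t" by (simp add: eventually_at_right_less)
    ultimately have ev: "\<forall>\<^sub>F t in at_right (0::real). y + t *\<^sub>R a \<in> ball h e \<inter> {y. c < y \<bullet> a}"
      by eventually_elim (use that aa in \<open>simp add: inner_add_left\<close>)
    then have "\<exists>t. y + t *\<^sub>R a \<in> ball h e \<inter> {y. c < y \<bullet> a}"
      by (rule eventually_happens'[OF trivial_limit_at_right_real])
    then show "ball h e \<inter> {y. c < y \<bullet> a} \<noteq> {}" by blast
    have "\<forall>\<^sub>F t in at_right (0::real). y + t *\<^sub>R a \<in> closure (ball h e \<inter> {y. c < y \<bullet> a})"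
      using ev by eventually_elim (rule subsetD[OF closure_subset])
    then show "y \<in> closure (ball h e \<inter> {y. c < y \<bullet> a})"
      by (rule Lim_in_closed_set[OF closed_closure _ trivial_limit_at_right_real tendsto_ray])
  qed
  have "open (ball h e \<inter> {y. c < y \<bullet> a})"
    by (intro open_Int open_ball open_Collect_less continuous_intros)
  then have "aff_dim (ball h e \<inter> {y. c < y \<bullet> a}) = DIM('a)"
    using near(2)[of h] h \<open>e > 0\<close> by (intro aff_dim_open) auto
  then have dim: "aff_dim (closure S) = DIM('a)"
    using aff_dim_subset[OF sub] aff_dim_le_DIM[of S] by simp
  have hyp: "{x. x \<bullet> a = c} = {x. a \<bullet> x = c}" by (simp add: inner_commute)
  have "aff_dim ({x. a \<bullet> x = c} \<inter> ball h e) = aff_dim {x. a \<bullet> x = c}"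
    using h \<open>e > 0\<close> by (intro aff_dim_convex_Int_open convex_hyperplane open_ball) (auto simp: inner_commute)
  then have "aff_dim ({x. x \<bullet> a = c} \<inter> ball h e) = DIM('a) - 1"
    using \<open>a \<noteq> 0\<close> by (simp add: hyp aff_dim_hyperplane)
  moreover have "aff_dim ({x. x \<bullet> a = c} \<inter> ball h e) \<le> aff_dim ({x. x \<bullet> a = c} \<inter> closure S)"
    using near(1) closure_mono[OF sub] by (intro aff_dim_subset) blast
  moreover have "aff_dim ({x. x \<bullet> a = c} \<inter> closure S) \<le> DIM('a) - 1"
    using aff_dim_subset[of "{x. x \<bullet> a = c} \<inter> closure S" "{x. a \<bullet> x = c}"] \<open>a \<noteq> 0\<close>
    by (simp add: hyp aff_dim_hyperplane)
  ultimately have "aff_dim ({x. x \<bullet> a = c} \<inter> closure S) = DIM('a) - 1"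
    by linarith
  moreover have "(closure S \<inter> {x. a \<bullet> x = c}) face_of closure S"
    by (intro face_of_Int_supporting_hyperplane_ge convex_closure conv)
      (use closure_inner_ge[OF side] in \<open>simp add: inner_commute\<close>)
  moreover have "h \<in> {x. x \<bullet> a = c} \<inter> closure S"
    using near(1)[of h] h \<open>e > 0\<close> closure_mono[OF sub] by auto
  ultimately show ?thesis
    unfolding facet_of_def using dim by (auto simp: hyp Int_commute)
qed

text \<open>The set \<open>D\<close> of points with the signs of \<open>x\<close> is convex, hence
  connected and contained in \<open>C\<close>. Conversely, a sign change within the connected set
  \<open>C\<close> would put a point of \<open>C\<close> on a hyperplane.\<close>

lemma arrangement_region_cell:
  fixes \<A> :: "'a::euclidean_space set set"
  assumes \<A>: "\<A> = {root_hyperplane \<delta> d | \<delta> d. (\<delta>, d) \<in> I}"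
    and C: "C \<in> arrangement_regions \<A>" and x: "x \<in> C"
  shows "y \<in> C \<longleftrightarrow> (\<forall>(\<delta>, d)\<in>I. y \<bullet> \<delta> \<noteq> of_int d \<and> (of_int d < y \<bullet> \<delta> \<longleftrightarrow> of_int d < x \<bullet> \<delta>))"
    and "convex C"
proof -
  define D where "D = (\<Inter>(\<delta>, d)\<in>I. if of_int d < x \<bullet> \<delta> then {y. \<delta> \<bullet> y > of_int d} else {y. \<delta> \<bullet> y < of_int d})"
  have convD: "convex D"
    unfolding D_def by (intro convex_INT) (auto simp: convex_halfspace_lt convex_halfspace_gt)
  have comp: "C \<in> components (- \<Union>\<A>)" using C by (simp add: arrangement_regions_def)
  have avoid: "y \<bullet> \<delta> \<noteq> of_int d" if "y \<in> C" "(\<delta>, d) \<in> I" for y \<delta> d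
    using in_components_subset[OF comp] that by (auto simp: \<A> root_hyperplane_def)
  have D: "y \<in> D \<longleftrightarrow> (\<forall>(\<delta>, d)\<in>I. y \<bullet> \<delta> \<noteq> of_int d \<and> (of_int d < y \<bullet> \<delta> \<longleftrightarrow> of_int d < x \<bullet> \<delta>))" for y
    unfolding D_def by (fastforce simp: inner_commute split: if_splits)
  have "D \<subseteq> C"
  proof (rule components_maximal[OF comp])
    show "connected D" by (rule convex_connected[OF convD])
    show "D \<subseteq> - \<Union>\<A>"
    proof
      fix y assume "y \<in> D"
      then show "y \<in> - \<Union>\<A>" by (auto simp: D \<A> root_hyperplane_def)
    qed
    have "x \<in> D" using avoid[OF x] by (auto simp: D)
    then show "C \<inter> D \<noteq> {}" using x by blast
  qed
  moreover have "C \<subseteq> D"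
  proof
    fix y assume y: "y \<in> C"
    have conn: "connected C" by (rule in_components_connected[OF comp])
    have sign: "of_int d < v \<bullet> \<delta>" if uv: "u \<in> C" "v \<in> C" "of_int d < u \<bullet> \<delta>" and I: "(\<delta>, d) \<in> I" for \<delta> d u v
    proof (rule ccontr)
      assume "\<not> ?thesis"
      then have "\<exists>w\<in>C. \<delta> \<bullet> w = of_int d"
        using uv by (intro connected_ivt_hyperplane[OF conn, of v u]) (auto simp: inner_commute)
      then show False using avoid I by (auto simp: inner_commute)
    qed
    show "y \<in> D" using avoid[OF y] sign[OF x y] sign[OF y x] by (auto simp: D)
  qed
  ultimately have "C = D" by blast
  then show "y \<in> C \<longleftrightarrow> (\<forall>(\<delta>, d)\<in>I. y \<bullet> \<delta> \<noteq> of_int d \<and> (of_int d < y \<bullet> \<delta> \<longleftrightarrow> of_int d < x \<bullet> \<delta>))"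
    and "convex C" using D convD by simp_all
qed

section \<open>Sign descriptions of alcoves and Shi regions\<close>

lemma generic_point_iff: "generic_point \<Phi> x \<longleftrightarrow> x \<notin> \<Union>(affine_arrangement \<Phi>)"
  by (auto simp: generic_point_def affine_arrangement_def root_hyperplane_def elim!: Ints_cases)

lemma affine_arrangement_eq:
  "affine_arrangement \<Phi> = {root_hyperplane \<delta> d | \<delta> d. (\<delta>, d) \<in> \<Phi> \<times> UNIV}"
  by (auto simp: affine_arrangement_def)

lemma shi_arrangement_eq:
  "shi_arrangement P = {root_hyperplane \<delta> d | \<delta> d. (\<delta>, d) \<in> P \<times> {0, 1}}"
  by (auto simp: shi_arrangement_def)

lemma alcove_cell:
  assumes "A \<in> alcoves \<Phi>" "x \<in> A"
  shows "y \<in> A \<longleftrightarrow> generic_point \<Phi> y \<and> (\<forall>\<delta>\<in>\<Phi>. \<forall>m::int. of_int m < y \<bullet> \<delta> \<longleftrightarrow> of_int m < x \<bullet> \<delta>)"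
    and "convex A"
proof -
  note cell = arrangement_region_cell[OF affine_arrangement_eq assms(1)[unfolded alcoves_def] assms(2)]
  show "y \<in> A \<longleftrightarrow> generic_point \<Phi> y \<and> (\<forall>\<delta>\<in>\<Phi>. \<forall>m::int. of_int m < y \<bullet> \<delta> \<longleftrightarrow> of_int m < x \<bullet> \<delta>)"
    unfolding cell(1) by (auto simp: generic_point_def elim!: Ints_cases)
  show "convex A" by (rule cell(2))
qed

lemma shi_region_cell:
  assumes "R \<in> shi_regions P" "x \<in> R"
  shows "y \<in> R \<longleftrightarrow> (\<forall>\<delta>\<in>P. \<forall>m\<in>{0, 1::int}. y \<bullet> \<delta> \<noteq> of_int m \<and> (of_int m < y \<bullet> \<delta> \<longleftrightarrow> of_int m < x \<bullet> \<delta>))"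
    and "convex R"
proof -
  note cell = arrangement_region_cell[OF shi_arrangement_eq assms(1)[unfolded shi_regions_def] assms(2)]
  show "y \<in> R \<longleftrightarrow> (\<forall>\<delta>\<in>P. \<forall>m\<in>{0, 1::int}. y \<bullet> \<delta> \<noteq> of_int m \<and> (of_int m < y \<bullet> \<delta> \<longleftrightarrow> of_int m < x \<bullet> \<delta>))"
    unfolding cell(1) by blast
  show "convex R" by (rule cell(2))
qed

lemma alcove_coord_eq_floor:
  assumes A: "A \<in> alcoves \<Phi>" and x: "x \<in> A" and \<delta>: "\<delta> \<in> \<Phi>"
  shows "alcove_coord A \<delta> = \<lfloor>x \<bullet> \<delta>\<rfloor>"
  unfolding alcove_coord_def
proof (rule the_equality)
  show "\<forall>y\<in>A. of_int \<lfloor>x \<bullet> \<delta>\<rfloor> < y \<bullet> \<delta> \<and> y \<bullet> \<delta> < of_int \<lfloor>x \<bullet> \<delta>\<rfloor> + 1"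
  proof
    fix y assume y: "y \<in> A"
    have gen: "generic_point \<Phi> y" "generic_point \<Phi> x"
      and same: "\<And>m::int. of_int m < y \<bullet> \<delta> \<longleftrightarrow> of_int m < x \<bullet> \<delta>"
      using alcove_cell(1)[OF A x, of y] alcove_cell(1)[OF A x, of x] y x \<delta> by auto
    have "x \<bullet> \<delta> \<noteq> of_int \<lfloor>x \<bullet> \<delta>\<rfloor>" "y \<bullet> \<delta> \<noteq> of_int (\<lfloor>x \<bullet> \<delta>\<rfloor> + 1)"
      using gen \<delta> unfolding generic_point_def by (metis Ints_of_int)+
    then show "of_int \<lfloor>x \<bullet> \<delta>\<rfloor> < y \<bullet> \<delta> \<and> y \<bullet> \<delta> < of_int \<lfloor>x \<bullet> \<delta>\<rfloor> + 1"
      using same[of "\<lfloor>x \<bullet> \<delta>\<rfloor>"] same[of "\<lfloor>x \<bullet> \<delta>\<rfloor> + 1"] by (simp; linarith)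
  qed
  fix k assume "\<forall>y\<in>A. of_int k < y \<bullet> \<delta> \<and> y \<bullet> \<delta> < of_int k + 1"
  then have "of_int k < x \<bullet> \<delta>" "x \<bullet> \<delta> < of_int k + 1" using x by auto
  then show "k = \<lfloor>x \<bullet> \<delta>\<rfloor>" by linarith
qed

text \<open>The functional in \<open>hyperplane_separates\<close> is not tied to \<alpha>. The
  segment from the origin to \<open>y\<close> meets the hyperplane at \<open>t *\<^sub>R y\<close>
  with \<open>0 < t < 1\<close>, so \<open>y \<bullet> \<alpha>\<close> equals
  \<open>j / t\<close>.\<close>

lemma separates_origin_side:
  fixes \<alpha> :: "'a::euclidean_space"
  assumes "hyperplane_separates (root_hyperplane \<alpha> j) {0} C" "j > 0" "y \<in> C"
  shows "of_int j < y \<bullet> \<alpha>"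
proof -
  obtain a b where ab: "root_hyperplane \<alpha> j = {x. a \<bullet> x = b}" "0 < b" "b < a \<bullet> y"
    using assms by (auto simp: hyperplane_separates_def)
  define t where "t = b / (a \<bullet> y)"
  have t: "0 < t" "t < 1" using ab by (auto simp: t_def)
  have "t *\<^sub>R y \<in> root_hyperplane \<alpha> j" using ab by (simp add: t_def)
  then have "t * (y \<bullet> \<alpha>) = of_int j" by (simp add: root_hyperplane_def)
  moreover have "y \<bullet> \<alpha> > 0"
    using calculation t(1) assms(2) by (metis of_int_0_less_iff zero_less_mult_pos)
  then have "t * (y \<bullet> \<alpha>) < 1 * (y \<bullet> \<alpha>)" using t by (intro mult_strict_right_mono)
  ultimately show ?thesis by simp
qed

lemma hyperplane_separates_rootI:
  assumes "\<alpha> \<noteq> 0" "j > 0" "\<And>y. y \<in> C \<Longrightarrow> of_int j < y \<bullet> \<alpha>"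
  shows "hyperplane_separates (root_hyperplane \<alpha> j) {0} C"
  unfolding hyperplane_separates_def root_hyperplane_def
  by (rule exI[of _ \<alpha>], rule exI[of _ "of_int j"]) (use assms in \<open>auto simp: inner_commute\<close>)

context crystallographic_root_system
begin

section \<open>Walls as simple affine roots\<close>

lemma open_region:
  assumes \<A>: "\<A> = {root_hyperplane \<delta> d | \<delta> d. (\<delta>, d) \<in> I}" and I: "I \<subseteq> \<Phi> \<times> UNIV"
    and C: "C \<in> arrangement_regions \<A>"
  shows "open C"
proof (subst open_subopen, intro ballI)
  fix x assume x: "x \<in> C"
  note cell = arrangement_region_cell(1)[OF \<A> C x]
  \<comment> \<open>Even for infinite \<open>I\<close>, \<open>eventually_near_point\<close> at
    \<delta> and \<open>- \<delta>\<close> preserves all signs simultaneously.\<close>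
  have "\<forall>\<^sub>F y in nhds x. y \<in> C"
    using eventually_near_point[OF finite_roots, of x]
  proof eventually_elim
    case (elim y)
    have "y \<bullet> \<delta> \<noteq> of_int d \<and> (of_int d < y \<bullet> \<delta> \<longleftrightarrow> of_int d < x \<bullet> \<delta>)" if "(\<delta>, d) \<in> I" for \<delta> d
    proof -
      have \<delta>: "\<delta> \<in> \<Phi>" using that I by blast
      have "x \<bullet> \<delta> \<noteq> of_int d" using cell[of x] x that by blast
      then show ?thesis
        using bspec[OF elim \<delta>, THEN spec, of d] bspec[OF elim root_uminus[OF \<delta>], THEN spec, of "- d"]
        by auto
    qed
    then show ?case unfolding cell by blast
  qed
  then show "\<exists>T. open T \<and> x \<in> T \<and> T \<subseteq> C" by (auto simp: eventually_nhds)
qed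

lemma affine_hull_facet:
  assumes "open C" "\<alpha> \<in> \<Phi>" and facet: "(root_hyperplane \<alpha> j \<inter> closure C) facet_of closure C"
  shows "affine hull (root_hyperplane \<alpha> j \<inter> closure C) = root_hyperplane \<alpha> j"
proof -
  let ?F = "root_hyperplane \<alpha> j \<inter> closure C"
  have H: "root_hyperplane \<alpha> j = {x. \<alpha> \<bullet> x = of_int j}" by (auto simp: root_hyperplane_def inner_commute)
  have "C \<noteq> {}" using facet by (auto simp: facet_of_def)
  then have "aff_dim (closure C) = DIM('a)" using aff_dim_open[OF assms(1)] by simp
  then have F: "?F \<noteq> {}" "aff_dim ?F = DIM('a) - 1" using facet by (auto simp: facet_of_def)
  have aff: "affine (root_hyperplane \<alpha> j)" unfolding H by (rule affine_hyperplane)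
  show ?thesis
  proof (rule affine_dim_equal[OF affine_affine_hull aff])
    show "affine hull ?F \<noteq> {}" using F(1) by simp
    show "affine hull ?F \<subseteq> root_hyperplane \<alpha> j" by (intro hull_minimal aff) auto
    show "aff_dim (affine hull ?F) = aff_dim (root_hyperplane \<alpha> j)"
      using F(2) root_nonzero[OF assms(2)] by (simp add: H aff_dim_hyperplane)
  qed
qed

text \<open>On the facet the summands of a decomposition are nonnegative and add up to zero, so both
  vanish. As the facet spans its hyperplane, a summand would be parallel to \<alpha>, which
  \<open>root_add_distinct\<close> excludes.\<close>

lemma wall_imp_simple_affine_root:
  assumes A: "A \<in> alcoves \<Phi>" and p: "p \<in> A" and \<alpha>: "\<alpha> \<in> \<Phi>"
    and side: "\<And>y. y \<in> A \<Longrightarrow> of_int j < y \<bullet> \<alpha>"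
    and facet: "(root_hyperplane \<alpha> j \<inter> closure A) facet_of closure A"
  shows "simple_affine_root \<Phi> p \<alpha> j"
proof -
  let ?F = "root_hyperplane \<alpha> j \<inter> closure A"
  note cell = alcove_cell(1)[OF A p]
  have gen: "generic_point \<Phi> p" using cell p by blast
  have "open A"
    by (rule open_region[OF affine_arrangement_eq _ A[unfolded alcoves_def]]) simp
  then have hull: "affine hull ?F = root_hyperplane \<alpha> j" using affine_hull_facet \<alpha> facet by blast
  have ge: "of_int m \<le> f \<bullet> \<delta>" if "\<delta> \<in> \<Phi>" "of_int m < p \<bullet> \<delta>" "f \<in> ?F" for \<delta> m f
    by (rule closure_inner_ge[of A]) (use cell that in auto)
  have level: "f \<bullet> \<alpha> = of_int j" if "f \<in> ?F" for f using that by (simp add: root_hyperplane_def)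
  obtain f where f: "f \<in> ?F" using facet by (auto simp: facet_of_def)
  show ?thesis
    unfolding simple_affine_root_def
  proof (intro conjI notI \<alpha> side p)
    show "p \<bullet> \<alpha> < of_int j + 1"
    proof (rule ccontr)
      assume "\<not> ?thesis"
      moreover have "p \<bullet> \<alpha> \<noteq> of_int (j + 1)" using gen \<alpha> by (auto simp: generic_point_def)
      ultimately show False using ge[OF \<alpha> _ f, of "j + 1"] level[OF f] by simp
    qed
    assume "\<exists>\<delta> \<epsilon> m n. \<delta> \<in> \<Phi> \<and> \<epsilon> \<in> \<Phi> \<and> \<alpha> = \<delta> + \<epsilon> \<and> j = m + n \<and>
        of_int m < p \<bullet> \<delta> \<and> of_int n < p \<bullet> \<epsilon>"
    then obtain \<delta> \<epsilon> m n where dec: "\<delta> \<in> \<Phi>" "\<epsilon> \<in> \<Phi>" "\<alpha> = \<delta> + \<epsilon>" "j = m + n"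
        "of_int m < p \<bullet> \<delta>" "of_int n < p \<bullet> \<epsilon>" by blast
    have "f \<in> root_hyperplane \<delta> m" if "f \<in> ?F" for f
      using ge[OF dec(1,5) that] ge[OF dec(2,6) that] level[OF that] dec(3,4)
      by (simp add: root_hyperplane_def inner_add_right)
    then have "affine hull ?F \<subseteq> root_hyperplane \<delta> m"
      using affine_hyperplane[of \<delta> "of_int m"]
      by (intro hull_minimal) (auto simp: root_hyperplane_def inner_commute)
    then have "\<delta> = \<alpha> \<or> \<delta> = - \<alpha>"
      using root_hyperplane_subset[OF \<alpha> dec(1)] by (auto simp: hull)
    then show False using root_add_distinct[of \<delta> \<epsilon>] dec \<alpha> by auto
  qed
qed

text \<open>The other roots have nonzero projections orthogonal to \<alpha>, so some direction
  \<open>w\<close> in the hyperplane is orthogonal to none of them; a small move along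
  \<open>w\<close> makes their values non-integral.\<close>

lemma exists_generic_in_root_hyperplane:
  assumes \<alpha>: "\<alpha> \<in> \<Phi>" and h: "h \<in> root_hyperplane \<alpha> j" and "e > 0"
  obtains h' where "h' \<in> root_hyperplane \<alpha> j" "h' \<in> ball h e"
    "\<And>\<delta>. \<delta> \<in> \<Phi> \<Longrightarrow> \<delta> \<noteq> \<alpha> \<Longrightarrow> \<delta> \<noteq> - \<alpha> \<Longrightarrow> h' \<bullet> \<delta> \<notin> \<int>"
proof -
  have aa: "\<alpha> \<bullet> \<alpha> > 0" using root_nonzero[OF \<alpha>] by simp
  define proj where "proj v = v - ((v \<bullet> \<alpha>) / (\<alpha> \<bullet> \<alpha>)) *\<^sub>R \<alpha>" for v :: 'a
  have "0 \<notin> proj ` (\<Phi> - {\<alpha>, - \<alpha>})"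
  proof
    assume "0 \<in> proj ` (\<Phi> - {\<alpha>, - \<alpha>})"
    then obtain \<delta> where \<delta>: "0 = proj \<delta>" "\<delta> \<in> \<Phi> - {\<alpha>, - \<alpha>}" by (rule imageE)
    define c where "c = (\<delta> \<bullet> \<alpha>) / (\<alpha> \<bullet> \<alpha>)"
    have "\<delta> = c *\<^sub>R \<alpha>" using \<delta>(1) by (simp add: proj_def c_def)
    then show False using root_in_span_root[OF \<alpha>, of c] \<delta> by auto
  qed
  then have "\<exists>v. \<forall>d\<in>proj ` (\<Phi> - {\<alpha>, - \<alpha>}). v \<bullet> d \<noteq> 0"
    by (intro exists_nonorthogonal finite_imageI finite_Diff finite_roots)
  then obtain v where v: "\<And>\<delta>. \<delta> \<in> \<Phi> - {\<alpha>, - \<alpha>} \<Longrightarrow> v \<bullet> proj \<delta> \<noteq> 0" by blast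
  define w where "w = proj v"
  have w: "w \<bullet> \<alpha> = 0" "w \<bullet> \<delta> = v \<bullet> proj \<delta>" for \<delta>
    using aa by (simp_all add: w_def proj_def inner_diff_left inner_diff_right inner_commute)
  have "\<forall>\<^sub>F t in at_right (0::real). h + t *\<^sub>R w \<in> ball h e"
    by (rule topological_tendstoD[OF tendsto_ray]) (use \<open>e > 0\<close> in auto)
  moreover have "\<forall>\<^sub>F t in at_right 0. \<forall>\<delta>\<in>\<Phi> - {\<alpha>, - \<alpha>}. h \<bullet> \<delta> + t * (w \<bullet> \<delta>) \<notin> \<int>"
    using v finite_roots by (intro eventually_ball_finite ballI eventually_notin_Ints) (auto simp: w)
  ultimately have "\<forall>\<^sub>F t in at_right (0::real). h + t *\<^sub>R w \<in> ball h e \<and>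
      (\<forall>\<delta>\<in>\<Phi> - {\<alpha>, - \<alpha>}. h \<bullet> \<delta> + t * (w \<bullet> \<delta>) \<notin> \<int>)"
    by eventually_elim simp
  then obtain t where "h + t *\<^sub>R w \<in> ball h e" "\<forall>\<delta>\<in>\<Phi> - {\<alpha>, - \<alpha>}. h \<bullet> \<delta> + t * (w \<bullet> \<delta>) \<notin> \<int>"
    using eventually_happens'[OF trivial_limit_at_right_real] by blast
  then show ?thesis
    using h w(1) by (intro that[of "h + t *\<^sub>R w"]) (auto simp: root_hyperplane_def inner_add_left)
qed

text \<open>The starting point of the descent: from a facet point \<open>h\<close> on no other
  affine hyperplane, a short step along \<alpha> enters an alcove of \<open>R\<close> touching the
  facet.\<close>

lemma exists_simple_affine_root_at_facet:
  assumes "P \<subseteq> \<Phi>" and R: "R \<in> shi_regions P" and \<alpha>: "\<alpha> \<in> P"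
    and side: "\<And>y. y \<in> R \<Longrightarrow> 1 < y \<bullet> \<alpha>"
    and facet: "(root_hyperplane \<alpha> 1 \<inter> closure R) facet_of closure R"
  obtains x where "x \<in> R" "generic_point \<Phi> x" "simple_affine_root \<Phi> x \<alpha> 1"
proof -
  let ?F = "root_hyperplane \<alpha> 1 \<inter> closure R"
  have \<alpha>\<Phi>: "\<alpha> \<in> \<Phi>" using assms by blast
  have aa: "\<alpha> \<bullet> \<alpha> > 0" using root_nonzero[OF \<alpha>\<Phi>] by simp
  have "R \<noteq> {}" using facet by (auto simp: facet_of_def)
  then obtain r where r: "r \<in> R" by blast
  note cell = shi_region_cell[OF R r]
  have "open R"
    by (rule open_region[OF shi_arrangement_eq _ R[unfolded shi_regions_def]]) (use assms in auto)
  then have hull: "affine hull ?F = root_hyperplane \<alpha> 1" using affine_hull_facet \<alpha>\<Phi> facet by blast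
  have "convex ?F" using face_of_imp_convex facet by (auto simp: facet_of_def)
  moreover have "?F \<noteq> {}" using facet by (simp add: facet_of_def)
  ultimately have "rel_interior ?F \<noteq> {}" by (simp add: rel_interior_eq_empty)
  \<comment> \<open>A disc of the hyperplane around \<open>h0\<close> lies in the facet, so
    \<open>h0\<close> can be made generic without leaving the closure of \<open>R\<close>.\<close>
  then obtain h0 e where h0: "h0 \<in> ?F" "e > 0" "ball h0 e \<inter> root_hyperplane \<alpha> 1 \<subseteq> ?F"
    by (metis ex_in_conv hull mem_rel_interior_ball)
  obtain h where h: "h \<in> root_hyperplane \<alpha> 1" "h \<in> ball h0 e"
    and h_gen: "\<And>\<delta>. \<delta> \<in> \<Phi> \<Longrightarrow> \<delta> \<noteq> \<alpha> \<Longrightarrow> \<delta> \<noteq> - \<alpha> \<Longrightarrow> h \<bullet> \<delta> \<notin> \<int>"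
    using exists_generic_in_root_hyperplane[OF \<alpha>\<Phi> _ h0(2)] h0(1) by blast
  have hcl: "h \<in> closure R" using h h0(3) by blast
  have h1: "h \<bullet> \<alpha> = 1" using h(1) by (simp add: root_hyperplane_def)
  have "\<forall>\<^sub>F t in at_right (0::real). 0 < t" by (simp add: eventually_at_right_less)
  with eventually_near_ray[OF finite_roots, of h \<alpha>]
  have "\<forall>\<^sub>F t in at_right 0. 0 < t \<and>
    (\<forall>\<delta>\<in>\<Phi>. \<forall>m::int. of_int m < h \<bullet> \<delta> \<longrightarrow> of_int m < (h + t *\<^sub>R \<alpha>) \<bullet> \<delta>)"
    by eventually_elim simp
  then obtain t where t: "0 < t"
    "\<And>\<delta> m. \<delta> \<in> \<Phi> \<Longrightarrow> of_int m < h \<bullet> \<delta> \<Longrightarrow> of_int m < (h + t *\<^sub>R \<alpha>) \<bullet> \<delta>"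
    using eventually_happens'[OF trivial_limit_at_right_real] by blast
  define x where "x = h + t *\<^sub>R \<alpha>"
  have x1: "1 < x \<bullet> \<alpha>" using t(1) aa by (simp add: x_def inner_add_left h1)
  have up: "of_int m < x \<bullet> \<delta>" if "\<delta> \<in> \<Phi>" "of_int m < h \<bullet> \<delta>" for \<delta> m
    using t(2)[OF that] by (simp add: x_def)
  have down: "x \<bullet> \<delta> < of_int m" if "\<delta> \<in> \<Phi>" "h \<bullet> \<delta> < of_int m" for \<delta> m
    using up[OF root_uminus[OF that(1)], of "- m"] that(2) by simp
  have x2: "x \<bullet> \<alpha> < 2" using down[OF \<alpha>\<Phi>, of 2] h1 by simp
  have gen: "generic_point \<Phi> x"
    unfolding generic_point_def
  proof (intro ballI notI)
    fix \<delta> assume \<delta>: "\<delta> \<in> \<Phi>" and "x \<bullet> \<delta> \<in> \<int>"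
    then obtain m where m: "x \<bullet> \<delta> = of_int m" by (auto elim: Ints_cases)
    show False
    proof (cases "\<delta> = \<alpha> \<or> \<delta> = - \<alpha>")
      case True
      then have "of_int m = x \<bullet> \<alpha> \<or> of_int (- m) = x \<bullet> \<alpha>" using m by auto
      then have "\<exists>n::int. 1 < (of_int n :: real) \<and> (of_int n :: real) < 2" using x1 x2 by metis
      then show False by auto
    next
      case False
      then have "h \<bullet> \<delta> \<noteq> of_int m" using h_gen[OF \<delta>] by auto
      then consider "h \<bullet> \<delta> < of_int m" | "of_int m < h \<bullet> \<delta>" by linarith
      then show False using up[OF \<delta>, of m] down[OF \<delta>, of m] m by cases simp_all
    qed
  qed
  have "x \<in> R"
    unfolding cell(1)
  proof (intro ballI)
    fix \<delta> and m :: int assume \<delta>: "\<delta> \<in> P" and m: "m \<in> {0, 1}"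
    have \<delta>\<Phi>: "\<delta> \<in> \<Phi>" using assms(1) \<delta> by blast
    have ne: "x \<bullet> \<delta> \<noteq> of_int m" using gen \<delta>\<Phi> by (auto simp: generic_point_def)
    have "of_int m < x \<bullet> \<delta> \<longleftrightarrow> of_int m < r \<bullet> \<delta>"
    proof (cases "h \<bullet> \<delta> = of_int m")
      case True
      then have "\<delta> = \<alpha> \<or> \<delta> = - \<alpha>" using h_gen[OF \<delta>\<Phi>] by auto
      \<comment> \<open>The value of \<open>- \<alpha>\<close> at \<open>h\<close> is -1, so with
        \<open>m \<in> {0, 1}\<close> only \<alpha> at level 1 remains.\<close>
      then show ?thesis
        using True h1 m x1 side[OF r] by auto
    next
      case False
      show ?thesis
      proof (cases "of_int m < r \<bullet> \<delta>")
        case True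
        have "of_int m \<le> h \<bullet> \<delta>"
          by (rule closure_inner_ge[OF _ hcl]) (use cell(1) True \<delta> m in auto)
        then show ?thesis using False True up[OF \<delta>\<Phi>, of m] by auto
      next
        case not: False
        have "- of_int m < y \<bullet> (- \<delta>)" if "y \<in> R" for y
        proof -
          have "y \<bullet> \<delta> \<noteq> of_int m \<and> (of_int m < y \<bullet> \<delta> \<longleftrightarrow> of_int m < r \<bullet> \<delta>)"
            using cell(1)[of y] that \<delta> m by blast
          then show ?thesis using not by auto
        qed
        then have "- of_int m \<le> h \<bullet> (- \<delta>)"
          by (rule closure_inner_ge[OF _ hcl])
        then show ?thesis using False not down[OF \<delta>\<Phi>, of m] by auto
      qed
    qed
    with ne show "x \<bullet> \<delta> \<noteq> of_int m \<and> (of_int m < x \<bullet> \<delta> \<longleftrightarrow> of_int m < r \<bullet> \<delta>)" by blast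
  qed
  moreover have "simple_affine_root \<Phi> x \<alpha> 1"
    unfolding simple_affine_root_def
  proof (intro conjI notI)
    show "\<alpha> \<in> \<Phi>" "of_int 1 < x \<bullet> \<alpha>" "x \<bullet> \<alpha> < of_int 1 + 1" using \<alpha>\<Phi> x1 x2 by auto
    assume "\<exists>\<delta> \<epsilon> m n. \<delta> \<in> \<Phi> \<and> \<epsilon> \<in> \<Phi> \<and> \<alpha> = \<delta> + \<epsilon> \<and> 1 = m + n \<and>
        of_int m < x \<bullet> \<delta> \<and> of_int n < x \<bullet> \<epsilon>"
    then obtain \<delta> \<epsilon> m n where dec: "\<delta> \<in> \<Phi>" "\<epsilon> \<in> \<Phi>" "\<alpha> = \<delta> + \<epsilon>" "1 = m + n"
        "of_int m < x \<bullet> \<delta>" "of_int n < x \<bullet> \<epsilon>" by blast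
    \<comment> \<open>Both summands are nonnegative at \<open>h\<close> and add up to zero there, so
      \<open>h\<close> would lie on the hyperplane of \<delta>.\<close>
    have "of_int m \<le> h \<bullet> \<delta>" "of_int n \<le> h \<bullet> \<epsilon>"
      using down[OF dec(1), of m] down[OF dec(2), of n] dec(5,6) by fastforce+
    moreover have "h \<bullet> \<delta> + h \<bullet> \<epsilon> = of_int (m + n)"
      using h1 dec(3,4) by (simp add: inner_add_right)
    ultimately have "h \<bullet> \<delta> = of_int m" by simp
    then have "\<delta> = \<alpha> \<or> \<delta> = - \<alpha>" using h_gen[OF dec(1)] by auto
    then show False using root_add_distinct[of \<delta> \<epsilon>] dec \<alpha>\<Phi> by auto
  qed
  ultimately show ?thesis using that gen by blast
qed

text \<open>The converse passage to walls. At the orthogonal projection \<open>h\<close> of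
  \<open>p\<close>, only \<open>(\<alpha>, j)\<close> loses strict positivity, so the part of a
  small ball beyond the wall lies in the alcove.\<close>

lemma simple_affine_root_half_ball:
  assumes A: "A \<in> alcoves \<Phi>" and p: "p \<in> A" and simple: "simple_affine_root \<Phi> p \<alpha> j"
  obtains h e where "h \<bullet> \<alpha> = of_int j" "e > 0" "ball h e \<inter> {y. of_int j < y \<bullet> \<alpha>} \<subseteq> A"
    "\<And>\<delta> m. \<delta> \<in> \<Phi> \<Longrightarrow> of_int m < p \<bullet> \<delta> \<Longrightarrow> of_int m < h \<bullet> \<delta> \<or> \<delta> = \<alpha> \<and> m = j"
proof -
  note cell = alcove_cell(1)[OF A p]
  have gen: "generic_point \<Phi> p" using cell p by blast
  have \<alpha>: "\<alpha> \<in> \<Phi>" "of_int j < p \<bullet> \<alpha>" using simple by (auto simp: simple_affine_root_def)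
  have aa: "\<alpha> \<bullet> \<alpha> > 0" using root_nonzero[OF \<alpha>(1)] by simp
  define s where "s = (p \<bullet> \<alpha> - of_int j) / (\<alpha> \<bullet> \<alpha>)"
  define h where "h = p - s *\<^sub>R \<alpha>"
  have s: "s > 0" using \<alpha> aa by (simp add: s_def)
  have h: "h \<bullet> \<alpha> = of_int j" using aa by (simp add: h_def s_def inner_diff_left)
  have "p \<bullet> \<delta> \<le> h \<bullet> \<delta>" if "\<delta> \<bullet> \<alpha> \<le> 0" for \<delta>
    using mult_nonneg_nonpos[of s "\<alpha> \<bullet> \<delta>"] s that
    by (simp add: h_def inner_diff_left inner_commute[of \<delta> \<alpha>])
  then have pos': "of_int m < h \<bullet> \<delta> \<or>
      (\<exists>a b::nat. \<delta> = of_nat a *\<^sub>R \<alpha> + of_nat b *\<^sub>R \<alpha> \<and> m = int a * j + int b * j)"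
    if "\<delta> \<in> \<Phi>" "of_int m < p \<bullet> \<delta>" for \<delta> m
    by (rule positive_affine_root_at_projection[OF gen simple simple h h _ that])
  have pos: "of_int m < h \<bullet> \<delta> \<or> \<delta> = \<alpha> \<and> m = j" if \<delta>: "\<delta> \<in> \<Phi>" "of_int m < p \<bullet> \<delta>" for \<delta> m
    using pos'[OF \<delta>]
  proof (elim disjE exE conjE)
    fix a b :: nat
    assume ab: "\<delta> = of_nat a *\<^sub>R \<alpha> + of_nat b *\<^sub>R \<alpha>" "m = int a * j + int b * j"
    then have "\<delta> = of_nat (a + b) *\<^sub>R \<alpha>" by (simp add: algebra_simps)
    then have "of_nat (a + b) = (1::real)" using root_in_span_root[OF \<alpha>(1), of "of_nat (a + b)"] \<delta> by auto
    then have "a = 1 \<and> b = 0 \<or> a = 0 \<and> b = 1" by linarith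
    then show ?thesis using ab by auto
  qed auto
  obtain e where e: "e > 0"
    "\<And>y \<delta> m. y \<in> ball h e \<Longrightarrow> \<delta> \<in> \<Phi> \<Longrightarrow> of_int m < h \<bullet> \<delta> \<Longrightarrow> of_int m < y \<bullet> \<delta>"
    using eventually_near_point[OF finite_roots, of h]
    unfolding eventually_nhds_metric by (auto simp: dist_commute)
  have "ball h e \<inter> {y. of_int j < y \<bullet> \<alpha>} \<subseteq> A"
  proof
    fix y assume y: "y \<in> ball h e \<inter> {y. of_int j < y \<bullet> \<alpha>}"
    have up: "of_int m < y \<bullet> \<delta>" if "\<delta> \<in> \<Phi>" "of_int m < p \<bullet> \<delta>" for \<delta> m
      using pos[OF that] e(2)[of y \<delta> m] y that(1) by auto
    have "y \<bullet> \<delta> \<noteq> of_int m \<and> (of_int m < y \<bullet> \<delta> \<longleftrightarrow> of_int m < p \<bullet> \<delta>)" if \<delta>: "\<delta> \<in> \<Phi>" for \<delta> m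
      using generic_pos_or_neg[OF gen \<delta>, of m] up[OF \<delta>, of m] up[OF root_uminus[OF \<delta>], of "- m"]
      by auto
    then show "y \<in> A" unfolding cell generic_point_def by (auto elim!: Ints_cases)
  qed
  then show ?thesis using that h e(1) pos by blast
qed

end

section \<open>Comparison of the two sets of floors\<close>

theorem theorem2p3:
  fixes \<Phi> P R A :: "'a::euclidean_space set"
  assumes "root_system \<Phi>" and "crystallographic \<Phi>" and "irreducible_roots \<Phi>"
    and "positive_system \<Phi> P"
    and "R \<in> shi_regions P"
    and "minimal_alcove \<Phi> P R A"
  shows "floors (affine_arrangement \<Phi>) A = floors (shi_arrangement P) R"
proof -
  interpret crystallographic_root_system \<Phi> by unfold_locales fact+
  obtain v where v: "\<forall>\<alpha>\<in>\<Phi>. v \<bullet> \<alpha> \<noteq> 0" "P = {\<alpha>\<in>\<Phi>. v \<bullet> \<alpha> > 0}"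
    using assms(4) by (auto simp: positive_system_def)
  have P: "P \<subseteq> \<Phi>" using v by blast
  have P_or: "\<delta> \<in> P \<or> - \<delta> \<in> P" if "\<delta> \<in> \<Phi>" for \<delta>
    using v that root_uminus[OF that] by (auto simp: linorder_neq_iff)
  note R = \<open>R \<in> shi_regions P\<close>
  have A: "A \<in> alcoves \<Phi>" and AR: "A \<subseteq> R"
    and coord: "\<And>\<delta> B. \<delta> \<in> P \<Longrightarrow> B \<in> alcoves \<Phi> \<Longrightarrow> B \<subseteq> R \<Longrightarrow> \<bar>alcove_coord A \<delta>\<bar> \<le> \<bar>alcove_coord B \<delta>\<bar>"
    using assms(6) by (auto simp: minimal_alcove_def)
  have "A \<noteq> {}"
    using A in_components_nonempty unfolding alcoves_def arrangement_regions_def by blast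
  then obtain p where p: "p \<in> A" by blast
  have pR: "p \<in> R" using p AR by blast
  have gen_p: "generic_point \<Phi> p" using alcove_cell(1)[OF A p] p by blast
  have same: "of_int m < x \<bullet> \<delta> \<longleftrightarrow> of_int m < y \<bullet> \<delta>"
    if "x \<in> R" "y \<in> R" "\<delta> \<in> P" "m \<in> {0, 1::int}" for x y \<delta> m
    using shi_region_cell(1)[OF R that(1), of y] that(2-4) by blast
  have mem: "y \<in> R" if "x \<in> R" "generic_point \<Phi> y"
    "\<And>\<delta> m. \<delta> \<in> P \<Longrightarrow> m \<in> {0, 1::int} \<Longrightarrow> of_int m < x \<bullet> \<delta> \<longleftrightarrow> of_int m < y \<bullet> \<delta>" for x y
    unfolding shi_region_cell(1)[OF R that(1)]
  proof (intro ballI conjI)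
    fix \<delta> and m :: int assume \<delta>: "\<delta> \<in> P" "m \<in> {0, 1}"
    have "y \<bullet> \<delta> \<notin> \<int>" using that(2) P \<delta>(1) by (auto simp: generic_point_def)
    then show "y \<bullet> \<delta> \<noteq> of_int m" by auto
    show "of_int m < y \<bullet> \<delta> \<longleftrightarrow> of_int m < x \<bullet> \<delta>" using that(3)[OF \<delta>] by blast
  qed
  have floor_le: "\<bar>\<lfloor>p \<bullet> \<delta>\<rfloor>\<bar> \<le> \<bar>\<lfloor>y \<bullet> \<delta>\<rfloor>\<bar>" if y: "y \<in> R" "generic_point \<Phi> y" and \<delta>: "\<delta> \<in> P" for y \<delta>
  proof -
    \<comment> \<open>The alcove of \<open>y\<close> lies in \<open>R\<close> because the affine
      arrangement contains the Shi arrangement.\<close>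
    obtain B where B: "B \<in> components (- \<Union>(affine_arrangement \<Phi>))" "y \<in> B"
      using y(2) Union_components[of "- \<Union>(affine_arrangement \<Phi>)"] unfolding generic_point_iff by blast
    have alc: "B \<in> alcoves \<Phi>" using B(1) by (simp add: alcoves_def arrangement_regions_def)
    have "B \<subseteq> R"
    proof (rule components_maximal)
      show "R \<in> components (- \<Union>(shi_arrangement P))"
        using R by (simp add: shi_regions_def arrangement_regions_def)
      show "connected B" by (rule in_components_connected[OF B(1)])
      have "shi_arrangement P \<subseteq> affine_arrangement \<Phi>"
        using P by (auto simp: shi_arrangement_def affine_arrangement_def)
      then show "B \<subseteq> - \<Union>(shi_arrangement P)" using in_components_subset[OF B(1)] by blast
      show "R \<inter> B \<noteq> {}" using y(1) B(2) by blast
    qed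
    then have "\<bar>alcove_coord A \<delta>\<bar> \<le> \<bar>alcove_coord B \<delta>\<bar>" by (rule coord[OF \<delta> alc])
    then show ?thesis
      using alcove_coord_eq_floor[OF A p, of \<delta>] alcove_coord_eq_floor[OF alc B(2), of \<delta>] P \<delta> by auto
  qed
  \<comment> \<open>The level 0 hyperplanes fix the sign of \<delta> on \<open>R\<close>, which
    resolves the absolute values in \<open>floor_le\<close>; for \<open>- \<delta> \<in> P\<close>
    the floors are negative and the inequality reverses.\<close>
  have min: "of_int m < y \<bullet> \<delta>"
    if y: "y \<in> R" "generic_point \<Phi> y" and \<delta>: "\<delta> \<in> \<Phi>" and m: "m \<ge> (1::int)" "of_int m < p \<bullet> \<delta>" for y \<delta> m
  proof -
    have ne: "y \<bullet> \<delta> \<noteq> of_int n" for n using y(2) \<delta> by (auto simp: generic_point_def)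
    have m1: "(1::real) \<le> of_int m" using m(1) by simp
    from P_or[OF \<delta>] show ?thesis
    proof
      assume \<delta>P: "\<delta> \<in> P"
      have "0 < y \<bullet> \<delta>" using same[OF pR y(1) \<delta>P, of 0] m(2) m1 by simp
      then have "\<lfloor>p \<bullet> \<delta>\<rfloor> \<le> \<lfloor>y \<bullet> \<delta>\<rfloor>" using floor_le[OF y \<delta>P] by simp
      moreover have "m \<le> \<lfloor>p \<bullet> \<delta>\<rfloor>" using m(2) by linarith
      ultimately have "m \<le> \<lfloor>y \<bullet> \<delta>\<rfloor>" by simp
      then show ?thesis using ne[of m] by (simp add: le_floor_iff)
    next
      assume \<delta>P: "- \<delta> \<in> P"
      have "\<not> 0 < y \<bullet> (- \<delta>)" using same[OF pR y(1) \<delta>P, of 0] m(2) m1 by simp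
      then have "y \<bullet> (- \<delta>) < 0" using ne[of 0] by simp
      moreover have "p \<bullet> (- \<delta>) < of_int (- m)" using m(2) by simp
      then have "\<lfloor>p \<bullet> (- \<delta>)\<rfloor> < - m" by (simp only: floor_less_iff)
      moreover have "\<bar>\<lfloor>p \<bullet> (- \<delta>)\<rfloor>\<bar> \<le> \<bar>\<lfloor>y \<bullet> (- \<delta>)\<rfloor>\<bar>" by (rule floor_le[OF y \<delta>P])
      ultimately have "\<lfloor>y \<bullet> (- \<delta>)\<rfloor> < - m" using m(1) by linarith
      then have "y \<bullet> (- \<delta>) < of_int (- m)" by (simp only: floor_less_iff)
      then show ?thesis by simp
    qed
  qed

  show ?thesis
  proof (intro equalityI subsetI)
    fix H assume "H \<in> floors (shi_arrangement P) R"
    then have H: "H \<in> shi_arrangement P" "(H \<inter> closure R) facet_of closure R" "0 \<notin> H"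
      "hyperplane_separates H {0} R"
      by (auto simp: floors_def walls_def)
    obtain \<alpha> d where \<alpha>: "\<alpha> \<in> P" "d \<in> {0, 1::int}" "H = root_hyperplane \<alpha> d"
      using H(1) by (auto simp: shi_arrangement_def)
    have "d = 1" using \<alpha>(2,3) H(3) by (auto simp: root_hyperplane_def)
    with \<alpha> have \<alpha>H: "H = root_hyperplane \<alpha> 1" by simp
    have \<alpha>\<Phi>: "\<alpha> \<in> \<Phi>" using \<alpha>(1) P by blast
    have sideR: "1 < y \<bullet> \<alpha>" if "y \<in> R" for y
      using separates_origin_side[of \<alpha> 1 R y] H(4) that by (simp add: \<alpha>H)
    obtain x where x: "x \<in> R" "generic_point \<Phi> x" "simple_affine_root \<Phi> x \<alpha> 1"
      using exists_simple_affine_root_at_facet[OF P R \<alpha>(1) sideR H(2)[unfolded \<alpha>H]] by blast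
    have "simple_affine_root \<Phi> p \<alpha> 1"
      by (rule simple_affine_root_descent[OF P P_or same mem min pR gen_p \<alpha>(1) x])
    then obtain h e where he: "h \<bullet> \<alpha> = of_int 1" "e > 0" "ball h e \<inter> {y. of_int 1 < y \<bullet> \<alpha>} \<subseteq> A"
      using simple_affine_root_half_ball[OF A p] by metis
    have sideA: "of_int 1 < y \<bullet> \<alpha>" if "y \<in> A" for y using sideR that AR by auto
    have "(H \<inter> closure A) facet_of closure A"
      using half_ball_facet[OF alcove_cell(2)[OF A p] sideA root_nonzero[OF \<alpha>\<Phi>] he]
      by (simp add: \<alpha>H root_hyperplane_def)
    moreover have "hyperplane_separates H {0} A"
      unfolding \<alpha>H by (rule hyperplane_separates_rootI[OF root_nonzero[OF \<alpha>\<Phi>] _ sideA]) simp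
    moreover have "H \<in> affine_arrangement \<Phi>" using \<alpha>H \<alpha>\<Phi> by (auto simp: affine_arrangement_def)
    ultimately show "H \<in> floors (affine_arrangement \<Phi>) A" using H(3) by (simp add: floors_def walls_def)
  next
    fix H assume "H \<in> floors (affine_arrangement \<Phi>) A"
    then have H: "H \<in> affine_arrangement \<Phi>" "(H \<inter> closure A) facet_of closure A" "0 \<notin> H"
      "hyperplane_separates H {0} A"
      by (auto simp: floors_def walls_def)
    obtain \<gamma> d where \<gamma>: "\<gamma> \<in> \<Phi>" "H = root_hyperplane \<gamma> d"
      using H(1) by (auto simp: affine_arrangement_def)
    \<comment> \<open>As \<open>H\<close> misses the origin, negating root and level if necessary
      makes the level positive.\<close>
    have "d \<noteq> 0" using \<gamma>(2) H(3) by (auto simp: root_hyperplane_def)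
    moreover have "root_hyperplane \<gamma> d = root_hyperplane (- \<gamma>) (- d)" by (auto simp: root_hyperplane_def)
    ultimately obtain \<alpha> j where \<alpha>: "\<alpha> \<in> \<Phi>" "H = root_hyperplane \<alpha> j" "j > 0"
      using \<gamma> root_uminus[OF \<gamma>(1)] by (metis linorder_neqE_linordered_idom neg_0_less_iff_less)
    have sideA: "of_int j < y \<bullet> \<alpha>" if "y \<in> A" for y
      using separates_origin_side[of \<alpha> j A y] H(4) that \<alpha> by simp
    have "simple_affine_root \<Phi> p \<alpha> j"
      by (rule wall_imp_simple_affine_root[OF A p \<alpha>(1) sideA]) (use H(2) \<alpha>(2) in simp_all)
    then obtain h e where he: "h \<bullet> \<alpha> = of_int j" "e > 0" "ball h e \<inter> {y. of_int j < y \<bullet> \<alpha>} \<subseteq> A"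
      and pos: "\<And>\<delta> m. \<delta> \<in> \<Phi> \<Longrightarrow> of_int m < p \<bullet> \<delta> \<Longrightarrow> of_int m < h \<bullet> \<delta> \<or> \<delta> = \<alpha> \<and> m = j"
      using simple_affine_root_half_ball[OF A p] by metis
    have "\<alpha> \<in> P \<and> j = 1"
    proof (rule ccontr)
      \<comment> \<open>Otherwise the alcove across the wall lies in \<^term>\<open>R\<close> and is closer to the origin.\<close>
      assume not_shi: "\<not> ?thesis"
      have "\<forall>\<^sub>F t in at_right (0::real). 0 < t" by (simp add: eventually_at_right_less)
      with eventually_near_ray[OF finite_roots, of h "- \<alpha>"]
      have "\<forall>\<^sub>F t in at_right 0. 0 < t \<and>
        (\<forall>\<delta>\<in>\<Phi>. \<forall>m::int. of_int m < h \<bullet> \<delta> \<longrightarrow> of_int m < (h + t *\<^sub>R (- \<alpha>)) \<bullet> \<delta>)"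
        by eventually_elim simp
      then obtain t where t: "0 < t"
        "\<And>\<delta> m. \<delta> \<in> \<Phi> \<Longrightarrow> of_int m < h \<bullet> \<delta> \<Longrightarrow> of_int m < (h + t *\<^sub>R (- \<alpha>)) \<bullet> \<delta>"
        using eventually_happens'[OF trivial_limit_at_right_real] by blast
      define y where "y = h + t *\<^sub>R (- \<alpha>)"
      have y\<alpha>: "y \<bullet> \<alpha> < of_int j"
        using t(1) root_nonzero[OF \<alpha>(1)] by (simp add: y_def inner_diff_left he(1))
      have up: "of_int m < y \<bullet> \<delta> \<or> \<delta> = \<alpha> \<and> m = j" if "\<delta> \<in> \<Phi>" "of_int m < p \<bullet> \<delta>" for \<delta> m
        using pos[OF that] t(2)[OF that(1), of m] unfolding y_def by blast
      have gen_y: "generic_point \<Phi> y"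
        unfolding generic_point_def
      proof (intro ballI notI)
        fix \<delta> assume \<delta>: "\<delta> \<in> \<Phi>" and "y \<bullet> \<delta> \<in> \<int>"
        then obtain m where m: "y \<bullet> \<delta> = of_int m" by (auto elim: Ints_cases)
        from generic_pos_or_neg[OF gen_p \<delta>, of m] show False
        proof
          assume "of_int m < p \<bullet> \<delta>"
          from up[OF \<delta> this] show False using m y\<alpha> by auto
        next
          assume "of_int (- m) < p \<bullet> (- \<delta>)"
          from up[OF root_uminus[OF \<delta>] this] show False using m y\<alpha> by auto
        qed
      qed
      \<comment> \<open>Only \<open>(\<alpha>, j)\<close> and its opposite change sign between
        \<open>p\<close> and \<open>y\<close>. The former is excluded by \<open>not_shi\<close>, the
        latter by its negative level.\<close>
      have yR: "y \<in> R"
      proof (rule mem[OF pR gen_y])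
        fix \<delta> and m :: int assume \<delta>: "\<delta> \<in> P" and m: "m \<in> {0, 1}"
        have \<delta>\<Phi>: "\<delta> \<in> \<Phi>" using \<delta> P by blast
        have "of_int m < y \<bullet> \<delta>" if "of_int m < p \<bullet> \<delta>"
          using up[OF \<delta>\<Phi> that] not_shi \<delta> m \<alpha>(3) by auto
        moreover have "of_int (- m) < y \<bullet> (- \<delta>)" if "of_int (- m) < p \<bullet> (- \<delta>)"
          using up[OF root_uminus[OF \<delta>\<Phi>] that] m \<alpha>(3) by auto
        ultimately show "of_int m < p \<bullet> \<delta> \<longleftrightarrow> of_int m < y \<bullet> \<delta>"
          using generic_pos_or_neg[OF gen_p \<delta>\<Phi>, of m] by auto
      qed
      have "of_int j < y \<bullet> \<alpha>"
        by (rule min[OF yR gen_y \<alpha>(1)]) (use \<alpha>(3) sideA[OF p] in simp_all)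
      then show False using y\<alpha> by simp
    qed
    then have \<alpha>P: "\<alpha> \<in> P" and j: "j = 1" by simp_all
    have sideR: "of_int j < y \<bullet> \<alpha>" if "y \<in> R" for y
      using same[OF pR that \<alpha>P, of j] sideA[OF p] j by simp
    \<comment> \<open>The half ball in \<open>A\<close> also lies in \<open>R\<close>, so it
      exhibits the facet of \<open>R\<close> as well.\<close>
    have "(H \<inter> closure R) facet_of closure R"
      using half_ball_facet[OF shi_region_cell(2)[OF R pR] sideR root_nonzero[OF \<alpha>(1)] he(1,2)
          order_trans[OF he(3) AR]]
      by (simp add: \<alpha>(2) root_hyperplane_def)
    moreover have "hyperplane_separates H {0} R"
      unfolding \<alpha>(2) by (rule hyperplane_separates_rootI[OF root_nonzero[OF \<alpha>(1)] \<alpha>(3) sideR])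
    moreover have "H \<in> shi_arrangement P" using \<alpha>(2) j \<alpha>P by (auto simp: shi_arrangement_def)
    ultimately show "H \<in> floors (shi_arrangement P) R" using H(3) by (simp add: floors_def walls_def)
  qed
qed

end
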